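(* Let $n \equiv 0 \pmod 6$ with $n > 30$. Then $$\sigma(S_n) = \frac{1}{2}\binom{n}{n/2} + \sum_{i=0}^{n/3-1}\binom{n}{i}.$$ Moreover, there is exactly one cover of $S_n$ of size $\sigma(S_n)$ consisting only of maximal subgroups, namely the collection consisting of: all stabilizers in $S_n$ of partitions of $\{1,\dots,n\}$ into two blocks of size $n/2$ (subgroups of the form $S_{n/2}\wr S_2$); the alternating group $A_n$; and, for each $1\le i\le n/3-1$, all setwise stabilizers in $S_n$ of $i$-element subsets of $\{1,\dots,n\}$ (subgroups of the form $S_i\times S_{n-i}$).
   Context: A cover of a group $G$ is a finite collection of proper subgroups of $G$ whose set-theoretic union is $G$; the covering number $\sigma(G)$ is the smallest size of a cover of $G$. $S_n$ is the symmetric group on $\{1,\dots,n\}$ and $A_n$ the alternating group. The stabilizer of a partition $\{B_1,B_2\}$ means the set of $g\in S_n$ with $\{B_1^g,B_2^g\}=\{B_1,B_2\}$ (so $g$ may swap the blocks). *)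

theory Defs
  imports Complex_Main "HOL-Algebra.Sym_Groups"
begin

definition is_cover :: "('a, 'b) monoid_scheme \<Rightarrow> 'a set set \<Rightarrow> bool" where
  "is_cover G C \<longleftrightarrow> finite C \<and>
     (\<forall>H\<in>C. subgroup H G \<and> H \<noteq> carrier G) \<and> \<Union>C = carrier G"

definition covering_number :: "('a, 'b) monoid_scheme \<Rightarrow> nat" where
  "covering_number G = (LEAST k. \<exists>C. is_cover G C \<and> card C = k)"

definition maximal_subgroup :: "'a set \<Rightarrow> ('a, 'b) monoid_scheme \<Rightarrow> bool" where
  "maximal_subgroup H G \<longleftrightarrow> subgroup H G \<and> H \<noteq> carrier G \<and>
     (\<forall>K. subgroup K G \<and> H \<subseteq> K \<longrightarrow> K = H \<or> K = carrier G)"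

definition set_stabilizer :: "nat \<Rightarrow> nat set \<Rightarrow> (nat \<Rightarrow> nat) set" where
  "set_stabilizer n A = {g \<in> carrier (sym_group n). g ` A = A}"

definition partition_stabilizer :: "nat \<Rightarrow> nat set \<Rightarrow> (nat \<Rightarrow> nat) set" where
  "partition_stabilizer n B = {g \<in> carrier (sym_group n).
      {g ` B, g ` ({1..n} - B)} = {B, {1..n} - B}}"

definition optimal_cover :: "nat \<Rightarrow> (nat \<Rightarrow> nat) set set" where
  "optimal_cover n =
     {partition_stabilizer n B | B. B \<subseteq> {1..n} \<and> card B = n div 2}
     \<union> {carrier (alt_group n)}
     \<union> {set_stabilizer n A | A. A \<subseteq> {1..n} \<and> 1 \<le> card A \<and> card A \<le> n div 3 - 1}"

end

theory Submission
  imports Defs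
begin

text \<open>
  Write \<open>n = 6 * k\<close>. The collection covers because an odd permutation has an odd number of cycles: if
  all of them have length at least \<open>n / 3\<close>, there are either one or exactly three cycles of length
  \<open>n / 3\<close>, all lengths are even, and colouring the points of each cycle alternately gives a preserved
  partition into halves.

  Optimality and uniqueness come from a weight argument. Choose a test set of permutations, each in
  exactly one member of the collection: the \<open>n\<close>-cycles, and for every \<open>A\<close> with
  \<open>card A = i \<le> n / 3 - 1\<close> the permutations whose cycles are \<open>A\<close> and two further sets of prescribed
  sizes (for \<open>A = {}\<close> these are the elements charged to the alternating group). Give each test
  element the reciprocal of the number of test elements in its member, so that every member has
  weight 1. It then suffices that every proper subgroup \<open>M\<close> is contained in a member or has weight
  less than 1; maximality of the members follows as well.

  If \<open>M\<close> is primitive and does not contain the alternating group, Bochert's bound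
  \<open>card M * fact (n / 2) \<le> fact n\<close> shows that \<open>M\<close> is too small. If \<open>M\<close> preserves \<open>m \<ge> 3\<close> blocks of
  size \<open>b\<close>, then \<open>card M \<le> fact b ^ m * fact m\<close> is too small as well. If \<open>M\<close> fixes a set of size
  \<open>j\<close> with \<open>n / 3 \<le> j < n / 2\<close>, counting pairs of test elements and fixed \<open>j\<close>-sets bounds the weight
  by a sum of terms \<open>(n choose i) / (n choose j)\<close>.
\<close>

section \<open>Permutation groups\<close>

text \<open>All order comparisons share one threshold. If g has at most three cycles, then h is
  determined by the conjugate of g under h together with the images of three base points, so the
  class of g has at least \<open>fact n / n ^ 3\<close> elements. It is spread evenly over at most
  \<open>2 ^ n / 10\<close> sets of one level. Hence every member contains at least
  \<open>10 * fact n / (2 ^ n * n ^ 3)\<close> test elements, and a subgroup of smaller order has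
  weight below 1. The margin is narrow: for three blocks of size 12, where n = 36, the comparison
  holds by less than a factor 2, so the 10 matters; for three blocks of size 10 it fails, and n = 30
  is excluded. Stabilizers of sets of size j with n / 3 \<le> j < n / 2 lie above the threshold and
  meet the test elements of very many members. Comparing them with one member at a time gives
  nothing; normalising every member to weight 1 allows the contributions of all levels to be added
  and compared with \<open>n choose j\<close>.\<close>

locale permutation_group =
  fixes S :: "'a set" and M :: "('a \<Rightarrow> 'a) set"
  assumes finite_S: "finite S"
    and permutes_M: "g \<in> M \<Longrightarrow> g permutes S"
    and id_M: "id \<in> M"
    and comp_M: "g \<in> M \<Longrightarrow> h \<in> M \<Longrightarrow> g \<circ> h \<in> M"
    and inv_M: "g \<in> M \<Longrightarrow> inv' g \<in> M"
begin

lemma finite_M: "finite M"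
  using finite_subset[OF _ finite_permutations[OF finite_S]] permutes_M by blast

text \<open>Block systems are encoded as equivalence relations, whose classes are the blocks. The
  relation built from three-cycles below then fits the definition of primitivity directly.\<close>

definition invariant_relation :: "('a \<times> 'a) set \<Rightarrow> bool" where
  "invariant_relation R \<longleftrightarrow> equiv S R \<and> (\<forall>g\<in>M. \<forall>x y. (x, y) \<in> R \<longrightarrow> (g x, g y) \<in> R)"

definition primitive :: bool where
  "primitive \<longleftrightarrow> (\<forall>R. invariant_relation R \<longrightarrow> R \<subseteq> Id \<or> R = S \<times> S)"

definition transitive :: bool where
  "transitive \<longleftrightarrow> (\<forall>x\<in>S. \<forall>y\<in>S. \<exists>g\<in>M. g x = y)"

section \<open>Three-cycles in primitive groups and Bochert's bound\<close>

definition three_cycle_in :: "'a \<Rightarrow> 'a \<Rightarrow> 'a \<Rightarrow> bool" where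
  "three_cycle_in a b c \<longleftrightarrow> distinct [a, b, c] \<and> cycle_of_list [a, b, c] \<in> M"

lemma three_cycle_conj:
  assumes "g \<in> M" "three_cycle_in a b c"
  shows "three_cycle_in (g a) (g b) (g c)"
proof -
  have bij: "bij g" using permutes_M[OF assms(1)] by (rule permutes_bij)
  have "g \<circ> cycle_of_list [a, b, c] \<circ> inv' g = cycle_of_list (map g [a, b, c])"
    using assms(2) bij unfolding three_cycle_in_def by (intro conjugation_of_cycle) auto
  moreover have "g \<circ> cycle_of_list [a, b, c] \<circ> inv' g \<in> M"
    using assms comp_M inv_M unfolding three_cycle_in_def by blast
  ultimately show ?thesis
    using assms(2) bij_is_inj[OF bij] unfolding three_cycle_in_def by (auto simp: inj_eq)
qed

lemma three_cycle_rotate: "three_cycle_in a b c \<Longrightarrow> three_cycle_in b c a"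
  using cycle_of_list_rotate_independent[of "[a, b, c]" 1]
  unfolding three_cycle_in_def by auto

text \<open>The square of a three-cycle is its inverse.\<close>

lemma three_cycle_inverse:
  assumes "three_cycle_in a b c"
  shows "three_cycle_in b a c"
proof -
  have "cycle_of_list [b, a, c] = cycle_of_list [a, b, c] \<circ> cycle_of_list [a, b, c]"
    using assms unfolding three_cycle_in_def by (auto simp: fun_eq_iff transpose_def)
  thus ?thesis using assms comp_M unfolding three_cycle_in_def by auto
qed

lemma three_cycle_apply:
  assumes "three_cycle_in a b c"
  shows "cycle_of_list [a, b, c] a = b" "cycle_of_list [a, b, c] b = c"
    "cycle_of_list [a, b, c] c = a" "x \<notin> {a, b, c} \<Longrightarrow> cycle_of_list [a, b, c] x = x"
  using assms unfolding three_cycle_in_def by (auto simp: transpose_def)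

lemma three_cycle_in_S:
  assumes "three_cycle_in a b c"
  shows "a \<in> S" "b \<in> S" "c \<in> S"
proof -
  have "cycle_of_list [a, b, c] permutes S" "distinct [a, b, c]"
    using assms permutes_M unfolding three_cycle_in_def by auto
  thus "a \<in> S" "b \<in> S" "c \<in> S"
    using three_cycle_apply(1-3)[OF assms] permutes_not_in[of "cycle_of_list [a, b, c]" S a]
      permutes_not_in[of "cycle_of_list [a, b, c]" S b] permutes_not_in[of "cycle_of_list [a, b, c]" S c]
    by (auto simp del: cycle_of_list.simps)
qed

text \<open>Conjugating (a b c) by (b d e) replaces b by d and leaves a alone unless e = a; in that
  case (b d e) itself contains both a and d.\<close>

lemma three_cycle_trans:
  assumes p: "three_cycle_in a b c" and q: "three_cycle_in b d e" and "a \<noteq> d"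
  shows "\<exists>f. three_cycle_in a d f"
proof (cases "e = a")
  case True
  then have "three_cycle_in d a b" using q three_cycle_rotate by blast
  thus ?thesis using three_cycle_inverse by blast
next
  case False
  let ?q = "cycle_of_list [b, d, e]"
  have "a \<notin> {b, d, e}" using False assms unfolding three_cycle_in_def by auto
  hence "?q a = a" "?q b = d" using three_cycle_apply[OF q] by auto
  moreover have "?q \<in> M" using q unfolding three_cycle_in_def by auto
  ultimately show ?thesis using three_cycle_conj[OF _ p, of ?q] by auto
qed

text \<open>This relation is how primitivity enters Jordan's theorem: once a single three-cycle
  exists it is not contained in the identity, so any two points lie in a common three-cycle.\<close>

lemma invariant_relation_three_cycles:
  "invariant_relation {(a, b). a \<in> S \<and> b \<in> S \<and> (a = b \<or> (\<exists>c. three_cycle_in a b c))}"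
  (is "invariant_relation ?R")
  unfolding invariant_relation_def
proof (intro conjI equivI ballI allI impI)
  show "refl_on S ?R" by (auto simp: refl_on_def)
  show "sym ?R" using three_cycle_inverse by (fastforce simp: sym_def)
  show "trans ?R"
  proof (rule transI)
    fix a b d assume h: "(a, b) \<in> ?R" "(b, d) \<in> ?R"
    show "(a, d) \<in> ?R"
    proof (cases "a = b \<or> b = d \<or> a = d")
      case False
      then obtain c e where "three_cycle_in a b c" "three_cycle_in b d e" using h by auto
      then have "\<exists>f. three_cycle_in a d f" using False three_cycle_trans by blast
      then show ?thesis using h by auto
    qed (use h in auto)
  qed
  show "?R \<subseteq> S \<times> S" by auto
next
  fix g x y assume "g \<in> M" "(x, y) \<in> ?R"
  then show "(g x, g y) \<in> ?R"
    using three_cycle_conj permutes_in_image[OF permutes_M] by blast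
qed

text \<open>Some (a b c) exists, and c has to be exchanged for d. A three-cycle (c d e) through c
  and d does this by conjugation, in a way that depends on whether e is a, b or a new point.\<close>

lemma all_three_cycles:
  assumes "primitive" and "three_cycle_in u v w"
    and "a \<in> S" "b \<in> S" "d \<in> S" "distinct [a, b, d]"
  shows "three_cycle_in a b d"
proof -
  let ?R = "{(a, b). a \<in> S \<and> b \<in> S \<and> (a = b \<or> (\<exists>c. three_cycle_in a b c))}"
  have "(u, v) \<in> ?R" "u \<noteq> v"
    using assms(2) three_cycle_in_S unfolding three_cycle_in_def by auto
  hence "\<not> ?R \<subseteq> Id" by blast
  hence "?R = S \<times> S"
    using assms(1)[unfolded primitive_def, rule_format, OF invariant_relation_three_cycles] by simp
  hence rel: "(x, y) \<in> ?R" if "x \<in> S" "y \<in> S" for x y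
    using that by simp
  have ex: "\<exists>c. three_cycle_in x y c" if "x \<in> S" "y \<in> S" "x \<noteq> y" for x y
    using rel[OF that(1,2)] that(3) by simp
  obtain c where p: "three_cycle_in a b c" using ex[of a b] assms by auto
  show ?thesis
  proof (cases "c = d")
    case False
    obtain e where q: "three_cycle_in c d e"
      using ex[of c d] assms False three_cycle_in_S[OF p] by auto
    let ?p = "cycle_of_list [a, b, c]"
    have pM: "?p \<in> M" using p unfolding three_cycle_in_def by auto
    have "d \<notin> {a, b, c}" using assms False by auto
    hence pa: "?p a = b" "?p b = c" "?p c = a" "?p d = d"
      using three_cycle_apply[OF p] by auto
    consider "e = a" | "e = b" | "e \<noteq> a" "e \<noteq> b" by blast
    then show ?thesis
    proof cases
      case 1
      then have "three_cycle_in a c d" using q three_cycle_rotate by blast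
      \<comment> \<open>The cycle (a b c) carries the triple a, c, d to b, a, d, which is the
        inverse of the desired three-cycle.\<close>
      from three_cycle_conj[OF pM this] show ?thesis using pa three_cycle_inverse by simp
    next
      case 2
      then have "three_cycle_in b c d" using q three_cycle_rotate by blast
      \<comment> \<open>Conjugating twice carries b, c, d to c, a, d and then to a, b, d.\<close>
      from three_cycle_conj[OF pM three_cycle_conj[OF pM this]] show ?thesis using pa by simp
    next
      case 3
      have "a \<notin> {c, d, e}" "b \<notin> {c, d, e}"
        using 3 assms p unfolding three_cycle_in_def by auto
      \<comment> \<open>The cycle (c d e) fixes a and b and moves c to d.\<close>
      then show ?thesis
        using three_cycle_conj[OF _ p, of "cycle_of_list [c, d, e]"] three_cycle_apply[OF q] q
        unfolding three_cycle_in_def by metis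
    qed
  qed (use p in simp)
qed

text \<open>The two supports meet only in d, so x and y interfere only there: a point whose passage
  through the commutator avoids d comes back to itself. The exceptional points d, \<open>x d\<close>
  and \<open>y d\<close> form the cycle.\<close>

lemma commutator_three_cycle:
  assumes "x \<in> M" "y \<in> M" and x: "x permutes D" and y: "y permutes insert d G"
    and "D \<inter> G = {}" "d \<in> D" "x d \<noteq> d" "y d \<noteq> d"
  shows "three_cycle_in d (x d) (y d)"
proof -
  let ?c = "x \<circ> y \<circ> inv' x \<circ> inv' y"
  have xd: "x d \<in> D" and yd: "y d \<in> G"
    using assms permutes_in_image[OF x] permutes_in_image[OF y] by auto
  have dist: "distinct [d, x d, y d]" using xd yd assms by auto
  have ixx: "inv' x (x z) = z" "x (inv' x z) = z" "inv' y (y z) = z" "y (inv' y z) = z" for z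
    using permutes_inverses[OF x] permutes_inverses[OF y] by auto
  have xf: "x z = z" "inv' x z = z" if "z \<notin> D" for z
    using that permutes_not_in[OF x] permutes_not_in[OF permutes_inv[OF x]] by auto
  have yf: "y z = z" "inv' y z = z" if "z \<notin> G" "z \<noteq> d" for z
    using that permutes_not_in[OF y] permutes_not_in[OF permutes_inv[OF y]] by auto
  have inD: "inv' x z \<in> D \<longleftrightarrow> z \<in> D" for z using permutes_in_image[OF permutes_inv[OF x]] .
  have inG: "inv' y z \<in> insert d G \<longleftrightarrow> z \<in> insert d G" for z
    using permutes_in_image[OF permutes_inv[OF y]] .
  have disj: "z \<in> D \<Longrightarrow> z \<notin> G" for z using assms by auto
  have "?c = cycle_of_list [d, x d, y d]"
  proof
    fix z
    consider "z = d" | "z = x d" | "z = y d" | "z \<notin> {d, x d, y d}" "z \<in> D"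
      | "z \<notin> {d, x d, y d}" "z \<notin> D" by blast
    then show "?c z = cycle_of_list [d, x d, y d] z"
    proof cases
      case 1
      have "inv' y d \<noteq> d" using ixx assms by metis
      hence "inv' y d \<in> G" using inG by blast
      hence "inv' y d \<notin> D" using disj by blast
      thus ?thesis using 1 dist by (simp add: xf ixx transpose_def)
    next
      case 2
      have "inv' y (x d) = x d" using yf disj xd assms by metis
      moreover have "x (y d) = y d" using xf yd disj by blast
      ultimately show ?thesis using 2 dist by (auto simp add: ixx transpose_def)
    next
      case 3
      have "inv' x d \<in> D" "inv' x d \<noteq> d" using inD ixx assms by metis+
      hence "y (inv' x d) = inv' x d" using yf disj by blast
      thus ?thesis using 3 dist by (simp add: ixx transpose_def)
    next
      case 4
      have 1: "inv' y z = z" using 4 yf disj by blast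
      have "inv' x z \<in> D" using 4 inD by blast
      moreover have "inv' x z \<noteq> d" using 4 ixx by (metis insertCI)
      ultimately have "y (inv' x z) = inv' x z" using yf disj by blast
      thus ?thesis using 1 4 dist by (simp add: ixx transpose_def)
    next
      case 5
      have "inv' y z \<noteq> d" using 5 ixx by (metis insertCI)
      have "inv' y z \<notin> D"
      proof (cases "z \<in> G")
        case True
        then show ?thesis using inG[of z] \<open>inv' y z \<noteq> d\<close> disj by auto
      next
        case False
        then show ?thesis using yf 5 by auto
      qed
      thus ?thesis using 5 dist by (simp add: xf ixx transpose_def)
    qed
  qed
  moreover have "?c \<in> M" by (intro comp_M inv_M assms)
  ultimately show ?thesis using dist unfolding three_cycle_in_def by simp
qed

text \<open>Bochert's bound. A largest subset \<open>G\<close> of \<open>S\<close> such that only the identity of \<open>M\<close> is supported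
  in \<open>G\<close> gives \<open>fact (card G)\<close> distinct cosets of \<open>M\<close>. If \<open>2 * card G < card S\<close>, maximality yields
  two elements of \<open>M\<close> whose supports share exactly one point, and their commutator is a three-cycle.\<close>

theorem Bochert:
  assumes no3: "\<And>a b c. \<not> three_cycle_in a b c" and m: "2 * m \<le> card S"
  shows "card M * fact m \<le> (fact (card S) :: nat)"
proof -
  let ?P = "\<lambda>G. G \<subseteq> S \<and> (\<forall>g\<in>M. g permutes G \<longrightarrow> g = id)"
  define G where "G = arg_max card ?P"
  have "?P G \<and> (\<forall>G'. ?P G' \<longrightarrow> card G' \<le> card G)"
    unfolding G_def
  proof (rule arg_max_nat_lemma)
    show "?P {}" by simp
    show "\<forall>G. ?P G \<longrightarrow> card G < Suc (card S)" using finite_S by (simp add: card_mono less_Suc_eq_le)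
  qed
  hence G: "?P G" and max: "\<And>G'. ?P G' \<Longrightarrow> card G' \<le> card G" by simp_all
  have finG: "finite G" using G finite_S finite_subset by blast
  have "card S \<le> 2 * card G"
  proof (rule ccontr)
    assume less: "\<not> ?thesis"
    have "card (S - G) = card S - card G" using G finG by (simp add: card_Diff_subset)
    hence "card G < card (S - G)" using less by simp
    hence "\<not> ?P (S - G)" using max[of "S - G"] by linarith
    then obtain x where x: "x \<in> M" "x permutes (S - G)" "x \<noteq> id" by auto
    then obtain d where d: "x d \<noteq> d" by (auto simp: fun_eq_iff)
    hence dD: "d \<in> S - G" using permutes_not_in[OF x(2)] by blast
    hence "card G < card (insert d G)" using finG by simp
    hence "\<not> ?P (insert d G)" using max[of "insert d G"] by linarith
    then obtain y where y: "y \<in> M" "y permutes insert d G" "y \<noteq> id" using G dD by auto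
    have "y d \<noteq> d"
    proof
      assume "y d = d"
      hence "y permutes G" using permutes_superset[OF y(2), of G] by auto
      thus False using G y by blast
    qed
    thus False using commutator_three_cycle[OF x(1) y(1) x(2) y(2)] d dD no3 by blast
  qed
  hence "m \<le> card G" using m by simp
  have inj: "inj_on (\<lambda>(g, s). g \<circ> s) (M \<times> {s. s permutes G})"
  proof (rule inj_onI, clarify)
    fix g s g' s' assume h: "g \<in> M" "g' \<in> M" "s permutes G" "s' permutes G" "g \<circ> s = g' \<circ> s'"
    have "inv' g' (g z) = s' (inv' s z)" for z
      using fun_cong[OF h(5), of "inv' s z"] permutes_inverses[OF h(3)]
        permutes_inverses[OF permutes_M[OF h(2)]] by simp
    hence "inv' g' \<circ> g = s' \<circ> inv' s" by (simp add: fun_eq_iff)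
    moreover have "s' \<circ> inv' s permutes G" using h permutes_compose permutes_inv by blast
    moreover have "inv' g' \<circ> g \<in> M" using h inv_M comp_M by blast
    ultimately have "inv' g' \<circ> g = id" using G by metis
    hence "inv' g' (g z) = z" for z by (simp add: fun_eq_iff)
    hence "g z = g' z" for z using permutes_inverses(1)[OF permutes_M[OF h(2)], of "g z"] by simp
    hence "g = g'" by blast
    moreover have "inj g'" using permutes_inj permutes_M h by blast
    ultimately show "g = g' \<and> s = s'" using h by (auto simp: fun_eq_iff inj_eq)
  qed
  have "card M * fact (card G) = card (M \<times> {s. s permutes G})"
    using card_permutations[OF refl finG] by (simp add: card_cartesian_product)
  also have "\<dots> \<le> card {p. p permutes S}"
  proof (rule card_inj_on_le[OF inj])
    show "(\<lambda>(g, s). g \<circ> s) ` (M \<times> {s. s permutes G}) \<subseteq> {p. p permutes S}"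
      using permutes_M G by (auto intro!: permutes_compose intro: permutes_subset)
  qed (simp add: finite_permutations finite_S)
  finally have "card M * fact (card G) \<le> fact (card S)"
    using card_permutations[OF refl finite_S] by simp
  moreover have "(fact m :: nat) \<le> fact (card G)" using \<open>m \<le> card G\<close> by (rule fact_mono_nat)
  ultimately show ?thesis using mult_le_mono2 order_trans by blast
qed

end

section \<open>Orders of groups preserving a system of blocks\<close>

lemma card_extensional_bijections_le:
  assumes "finite X" "card Y = card X"
  shows "finite {f \<in> extensional X. bij_betw f X Y}"
    and "card {f \<in> extensional X. bij_betw f X Y} \<le> fact (card X)"
proof -
  let ?B = "{f \<in> extensional X. bij_betw f X Y}"
  have "finite ?B \<and> card ?B \<le> fact (card X)"
  proof (cases "?B = {}")
    case False
    then obtain h where h: "bij_betw h X Y" by blast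
    let ?F = "\<lambda>f x. if x \<in> X then inv_into X h (f x) else x"
    have inj: "inj_on ?F ?B"
    proof (rule inj_onI)
      fix f g assume fg: "f \<in> ?B" "g \<in> ?B" "?F f = ?F g"
      have "f x = g x" if "x \<in> X" for x
      proof -
        have "inv_into X h (f x) = inv_into X h (g x)" using fun_cong[OF fg(3), of x] that by simp
        moreover have "f x \<in> h ` X" "g x \<in> h ` X"
          using fg that h by (auto simp: bij_betw_def)
        ultimately show ?thesis by (metis f_inv_into_f)
      qed
      thus "f = g" using fg extensionalityI[of f X g] by blast
    qed
    have im: "?F ` ?B \<subseteq> {p. p permutes X}"
    proof safe
      fix f assume f: "bij_betw f X Y"
      have "bij_betw (inv_into X h \<circ> f) X X"
        using bij_betw_trans[OF f bij_betw_inv_into[OF h]] .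
      hence "bij_betw (?F f) X X" by (rule bij_betw_cong[THEN iffD1, rotated]) simp
      thus "?F f permutes X" by (rule bij_imp_permutes) simp
    qed
    have "finite {p. p permutes X}" using assms finite_permutations by blast
    thus ?thesis
      using card_inj_on_le[OF inj im] finite_imageD[OF finite_subset[OF im] inj]
        card_permutations[OF refl assms(1)] by simp
  next
    case True
    show ?thesis unfolding True by simp
  qed
  thus "finite ?B" "card ?B \<le> fact (card X)" by auto
qed

context permutation_group
begin

lemma invariant_relation_class_image:
  assumes R: "invariant_relation R" and "g \<in> M"
  shows "g ` (R `` {x}) = R `` {g x}"
proof -
  have invR: "\<And>g x y. g \<in> M \<Longrightarrow> (x, y) \<in> R \<Longrightarrow> (g x, g y) \<in> R"
    using R unfolding invariant_relation_def by auto
  have "(x, inv' g y) \<in> R" if "(g x, y) \<in> R" for y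
    using invR[OF inv_M[OF \<open>g \<in> M\<close>] that] permutes_inverses[OF permutes_M[OF \<open>g \<in> M\<close>]] by simp
  moreover have "y = g (inv' g y)" for y
    using permutes_inverses[OF permutes_M[OF \<open>g \<in> M\<close>]] by simp
  ultimately show ?thesis using invR[OF \<open>g \<in> M\<close>] by blast
qed

text \<open>An element is recovered from the permutation it induces on the classes and from its
  restrictions to them. Counting these data bounds the order by that of the wreath product of two
  symmetric groups, without constructing that group.\<close>

lemma card_invariant_relation_le:
  assumes R: "invariant_relation R"
    and b: "\<And>X. X \<in> S // R \<Longrightarrow> card X = b"
  shows "card M \<le> fact b ^ card (S // R) * fact (card (S // R))"
proof -
  let ?Q = "S // R"
  have eq: "equiv S R" and invR: "\<And>g x y. g \<in> M \<Longrightarrow> (x, y) \<in> R \<Longrightarrow> (g x, g y) \<in> R"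
    using R unfolding invariant_relation_def by auto
  have RS: "R \<subseteq> S \<times> S" using eq by (simp add: equiv_def)
  have finQ: "finite ?Q" using finite_quotient[OF finite_S RS] .
  have QS: "X \<subseteq> S" if "X \<in> ?Q" for X using that RS by (auto simp: quotient_def)
  have finX: "finite X" if "X \<in> ?Q" for X using QS[OF that] finite_S finite_subset by blast
  note img = invariant_relation_class_image[OF R]
  have imgQ: "g ` X \<in> ?Q" if "g \<in> M" "X \<in> ?Q" for g X
    using that img[OF that(1)] permutes_in_image[OF permutes_M[OF that(1)]] quotientI[of _ S R]
    by (elim quotientE) simp
  \<comment> \<open>The identity outside the quotient turns the induced action into a function that
    \<open>permutes\<close> the quotient.\<close>
  define \<sigma> where "\<sigma> g = (\<lambda>X. if X \<in> ?Q then g ` X else X)" for g :: "'a \<Rightarrow> 'a"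
  have \<sigma>: "\<sigma> g permutes ?Q" if "g \<in> M" for g
  proof (rule inj_imp_permutes[OF _ finQ])
    show "inj_on (\<sigma> g) ?Q"
      using permutes_inj[OF permutes_M[OF that]] unfolding \<sigma>_def
      by (auto intro!: inj_onI simp: inj_image_eq_iff)
  qed (use imgQ that in \<open>auto simp: \<sigma>_def\<close>)
  let ?T = "\<lambda>\<tau>. PiE ?Q (\<lambda>X. {f \<in> extensional X. bij_betw f X (\<tau> X)})"
  let ?D = "Sigma {\<tau>. \<tau> permutes ?Q} ?T"
  have finP: "finite {\<tau>. \<tau> permutes ?Q}" using finQ finite_permutations by blast
  have \<tau>c: "card (\<tau> X) = card X" if "\<tau> permutes ?Q" "X \<in> ?Q" for \<tau> X
    using that b permutes_in_image[OF that(1)] by simp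
  have finT: "finite (?T \<tau>)" if "\<tau> permutes ?Q" for \<tau>
    using finQ finX \<tau>c that by (intro finite_PiE) (auto intro!: card_extensional_bijections_le(1))
  have cT: "card (?T \<tau>) \<le> fact b ^ card ?Q" if "\<tau> permutes ?Q" for \<tau>
  proof -
    have "card (?T \<tau>) = (\<Prod>X\<in>?Q. card {f \<in> extensional X. bij_betw f X (\<tau> X)})"
      using finQ by (simp add: card_PiE)
    also have "\<dots> \<le> (\<Prod>X\<in>?Q. fact b)"
    proof (rule prod_mono)
      fix X assume X: "X \<in> ?Q"
      then show "0 \<le> card {f \<in> extensional X. bij_betw f X (\<tau> X)} \<and>
          card {f \<in> extensional X. bij_betw f X (\<tau> X)} \<le> fact b"
        using card_extensional_bijections_le(2)[OF finX[OF X] \<tau>c[OF that X]] b[OF X] by simp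
    qed
    finally show ?thesis by simp
  qed
  let ?\<phi> = "\<lambda>g. (\<sigma> g, \<lambda>X\<in>?Q. restrict g X)"
  have inj: "inj_on ?\<phi> M"
  proof (rule inj_onI)
    fix g h assume gh: "g \<in> M" "h \<in> M" "?\<phi> g = ?\<phi> h"
    hence e: "(\<lambda>X\<in>?Q. restrict g X) = (\<lambda>X\<in>?Q. restrict h X)" by simp
    have "g x = h x" for x
    proof (cases "x \<in> S")
      case True
      then have "R `` {x} \<in> ?Q" "x \<in> R `` {x}"
        using quotientI[of x S R] equiv_class_self[OF eq] by auto
      then show ?thesis using fun_cong[OF fun_cong[OF e, of "R `` {x}"], of x] by simp
    next
      case False
      then show ?thesis using gh permutes_not_in[OF permutes_M] by metis
    qed
    thus "g = h" by blast
  qed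
  have "bij_betw (restrict g X) X (\<sigma> g X)" if "g \<in> M" "X \<in> ?Q" for g X
    using that permutes_inj_on[OF permutes_M[OF that(1)], of X]
    by (auto simp: bij_betw_def \<sigma>_def inj_on_def)
  hence im: "?\<phi> ` M \<subseteq> ?D" using \<sigma> by auto
  have "card M \<le> card ?D"
    by (rule card_inj_on_le[OF inj im], rule finite_SigmaI) (use finT finP in auto)
  also have "\<dots> = (\<Sum>\<tau>\<in>{\<tau>. \<tau> permutes ?Q}. card (?T \<tau>))"
    using finP finT by (simp add: card_SigmaI)
  also have "\<dots> \<le> (\<Sum>\<tau>\<in>{\<tau>. \<tau> permutes ?Q}. fact b ^ card ?Q)"
    using cT by (intro sum_mono) simp
  also have "\<dots> = fact b ^ card ?Q * fact (card ?Q)"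
    using card_permutations[OF refl finQ] by simp
  finally show ?thesis .
qed

text \<open>Transitivity makes every class an image of one fixed class, which gives the common size.
  A pair off the diagonal gives two points in a class; a single class would make R
  everything.\<close>

lemma transitive_classes:
  assumes R: "invariant_relation R" "\<not> R \<subseteq> Id" "R \<noteq> S \<times> S" and tr: transitive
  obtains b where "\<And>X. X \<in> S // R \<Longrightarrow> card X = b" "card (S // R) * b = card S"
    "2 \<le> b" "2 \<le> card (S // R)"
proof -
  have eq: "equiv S R" using R unfolding invariant_relation_def by auto
  have RS: "R \<subseteq> S \<times> S" using eq by (simp add: equiv_def)
  have finQ: "finite (S // R)" using finite_quotient[OF finite_S RS] .
  obtain u v where uv: "(u, v) \<in> R" "u \<noteq> v" using R(2) by auto
  have uS: "u \<in> S" using uv RS by auto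
  define b where "b = card (R `` {u})"
  have card: "card X = b" if X: "X \<in> S // R" for X
  proof -
    obtain x where x: "x \<in> S" "X = R `` {x}" using X by (auto simp: quotient_def)
    obtain g where g: "g \<in> M" "g u = x" using tr x uS unfolding transitive_def by blast
    have "X = g ` (R `` {u})" using invariant_relation_class_image[OF R(1) g(1)] g x by simp
    thus ?thesis unfolding b_def
      using card_image permutes_inj_on permutes_M[OF g(1)] by blast
  qed
  have "R `` {u} \<subseteq> S" using RS by blast
  hence finu: "finite (R `` {u})" using finite_S finite_subset by blast
  have "{u, v} \<subseteq> R `` {u}" using uv equiv_class_self[OF eq uS] by auto
  hence b2: "2 \<le> b" unfolding b_def using uv(2) card_mono[OF finu, of "{u, v}"] by simp
  have "b * card (S // R) = card (\<Union> (S // R))"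
  proof (rule card_partition)
    show "c1 \<inter> c2 = {}" if "c1 \<in> S // R" "c2 \<in> S // R" "c1 \<noteq> c2" for c1 c2
      using quotient_disj[OF eq that(1,2)] that(3) by blast
  qed (use finQ finite_S Union_quotient[OF eq] card in auto)
  hence mul: "card (S // R) * b = card S" using Union_quotient[OF eq] by (simp add: mult.commute)
  have "2 \<le> card (S // R)"
  proof (rule ccontr)
    assume "\<not> ?thesis"
    moreover have "card (S // R) \<noteq> 0" using finQ quotientI[OF uS, of R] by auto
    ultimately have "card (S // R) = 1" by simp
    hence "S // R = {R `` {u}}" using quotientI[OF uS, of R] by (metis card_1_singletonE singletonD)
    hence uR: "R `` {u} = S" using Union_quotient[OF eq] by auto
    have "(x, y) \<in> R" if "x \<in> S" "y \<in> S" for x y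
    proof -
      have "(u, x) \<in> R" "(u, y) \<in> R" using uR that by blast+
      thus ?thesis using eq by (meson equivE symD transD)
    qed
    hence "R = S \<times> S" using RS by blast
    thus False using R by blast
  qed
  with card mul b2 that show thesis by blast
qed

end

section \<open>Numerical estimates\<close>

lemma Suc_cube_le:
  fixes m :: nat
  assumes "4 \<le> m"
  shows "Suc m ^ 3 \<le> 2 * m ^ 3"
proof -
  obtain c where "m = 4 + c" using assms le_Suc_ex by blast
  thus ?thesis by (simp add: power3_eq_cube algebra_simps)
qed

text \<open>With b = n / 2 this places groups satisfying Bochert's bound below the threshold. It
  fails at b = 15, that is n = 30. In the induction the left side grows by at most a factor 8, the
  right side by b + 1.\<close>

lemma two_power_cube_less_fact:
  fixes b :: nat
  assumes "18 \<le> b"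
  shows "2 ^ (2 * b) * (2 * b) ^ 3 < (10 * fact b :: nat)"
  using assms
proof (induction b rule: dec_induct)
  case base
  show ?case by (simp add: fact_numeral)
next
  case (step b)
  have "(b + 1) ^ 3 \<le> 2 * b ^ 3" using Suc_cube_le[of b] step.hyps by simp
  hence "4 * (b + 1) ^ 3 \<le> (b + 1) * b ^ 3"
    using step.hyps mult_le_mono1[of 8 "b + 1" "b ^ 3"] by linarith
  hence "2 ^ (2 * b) * (8 * (4 * (b + 1) ^ 3)) \<le> 2 ^ (2 * b) * (8 * ((b + 1) * b ^ 3))"
    by (intro mult_le_mono2)
  also have "\<dots> = (b + 1) * (2 ^ (2 * b) * (2 * b) ^ 3)"
    by (simp add: power_mult_distrib algebra_simps)
  also have "\<dots> < (b + 1) * (10 * fact b)"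
    using step.IH by (rule mult_strict_left_mono) simp
  also have "\<dots> = 10 * fact (Suc b)" by simp
  finally have "2 ^ (2 * b) * (8 * (4 * (b + 1) ^ 3)) < (10 * fact (Suc b) :: nat)" .
  moreover have "2 ^ (2 * Suc b) * (2 * Suc b) ^ 3 = 2 ^ (2 * b) * (8 * (4 * (b + 1) ^ 3))"
    unfolding power_mult_distrib by (simp del: mult_Suc)
  ultimately show ?case by metis
qed

text \<open>The order bound \<open>fact b ^ m * fact m\<close> for m blocks of size b is below the
  threshold \<open>10 * fact n / (2 ^ n * n ^ 3)\<close> at n = m * b, cleared of
  denominators.\<close>

definition blocks_bound :: "nat \<Rightarrow> nat \<Rightarrow> bool" where
  "blocks_bound m b \<longleftrightarrow>
     (m * b) ^ 3 * 2 ^ (m * b) * (fact b ^ m * fact m) < (10 * fact (m * b) :: nat)"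

text \<open>F is a lower bound for the growth of the factorial when a block is added. The factor
  \<open>m ^ 3\<close> clears the denominator of the ratio of the cubes.\<close>

lemma blocks_bound_step:
  assumes bb: "blocks_bound m b" and m: "0 < m"
    and f: "F * fact (m * b) \<le> (fact (Suc m * b) :: nat)"
    and r: "Suc m ^ 3 * (2 ^ b * (fact b * Suc m)) \<le> m ^ 3 * F"
  shows "blocks_bound (Suc m) b"
proof -
  let ?L = "(m * b) ^ 3 * 2 ^ (m * b) * (fact b ^ m * fact m)"
  have "m ^ 3 * ((Suc m * b) ^ 3 * 2 ^ (Suc m * b) * (fact b ^ Suc m * fact (Suc m)))
      = ?L * (Suc m ^ 3 * (2 ^ b * (fact b * Suc m)))"
    unfolding power_mult_distrib by (simp add: power_add algebra_simps)
  also have "\<dots> \<le> ?L * (m ^ 3 * F)" using r by (rule mult_le_mono2)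
  also have "\<dots> < (10 * fact (m * b)) * (m ^ 3 * F)"
  proof -
    have "0 < Suc m ^ 3 * (2 ^ b * (fact b * Suc m))" by simp
    hence "0 < m ^ 3 * F" using r by linarith
    thus ?thesis using bb unfolding blocks_bound_def by simp
  qed
  also have "\<dots> = (m ^ 3 * 10) * (F * fact (m * b))" by simp
  also have "\<dots> \<le> (m ^ 3 * 10) * fact (Suc m * b)" using f by (rule mult_le_mono2)
  also have "\<dots> = m ^ 3 * (10 * fact (Suc m * b))" by simp
  finally show ?thesis unfolding blocks_bound_def using m by simp
qed

text \<open>Each new factor satisfies m * b + i \<ge> (m + 1) * i, because i \<le> b.\<close>

lemma fact_add_ge:
  fixes m b j :: nat
  assumes "j \<le> b"
  shows "fact (m * b) * (Suc m ^ j * fact j) \<le> (fact (m * b + j) :: nat)"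
  using assms
proof (induction j)
  case (Suc j)
  have "Suc m * Suc j \<le> m * b + Suc j" using mult_le_mono2[OF Suc.prems, of m] by simp
  hence "(fact (m * b) * (Suc m ^ j * fact j)) * (Suc m * Suc j)
      \<le> fact (m * b + j) * (m * b + Suc j)"
    using Suc by (intro mult_le_mono) auto
  thus ?case by (simp add: algebra_simps)
qed simp

text \<open>For b \<ge> 4 the growth factor \<open>Suc m ^ b * fact b\<close> suffices: its power
  contains \<open>Suc m ^ 4\<close> and dominates \<open>2 ^ (b - 4)\<close> with the rest, while
  \<open>m ^ 3\<close> \<ge> 27 pays for the remaining \<open>2 ^ 4\<close>. For b = 2 and b = 3 the
  power is too short for this split, so the new factors of the factorial are written out.\<close>

lemma blocks_bound_Suc:
  assumes bb: "blocks_bound m b" and "3 \<le> m" "2 \<le> b" "36 \<le> m * b"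
  shows "blocks_bound (Suc m) b"
proof -
  consider "b = 2" | "b = 3" | "4 \<le> b" using assms by linarith
  then show ?thesis
  proof cases
    case 1
    have "18 \<le> m" using assms 1 by simp
    have "Suc m ^ 3 * (8 * Suc m) \<le> (2 * m ^ 3) * (8 * Suc m)"
      using Suc_cube_le[of m] \<open>18 \<le> m\<close> by (intro mult_le_mono1) simp
    also have "\<dots> = m ^ 3 * (Suc m * 16)" by simp
    also have "\<dots> \<le> m ^ 3 * (Suc m * (2 * (2 * m + 1)))"
      using \<open>18 \<le> m\<close> by (intro mult_le_mono2) simp
    finally have r: "Suc m ^ 3 * (8 * Suc m) \<le> m ^ 3 * (Suc m * (2 * (2 * m + 1)))" .
    have "Suc m * b = Suc (Suc (2 * m))" using 1 by simp
    hence e: "(fact (Suc m * b) :: nat) = (Suc m * (2 * (2 * m + 1))) * fact (2 * m)"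
      by (simp only: fact_Suc of_nat_id) (simp add: algebra_simps)
    show ?thesis
    proof (rule blocks_bound_step[OF bb])
      show "(Suc m * (2 * (2 * m + 1))) * fact (m * b) \<le> (fact (Suc m * b) :: nat)"
        unfolding e using 1 by (simp only: mult.commute[of m 2])
      show "Suc m ^ 3 * (2 ^ b * (fact b * Suc m)) \<le> m ^ 3 * (Suc m * (2 * (2 * m + 1)))"
        using r 1 by (simp del: power_Suc mult_Suc mult_Suc_right)
    qed (use assms in simp)
  next
    case 2
    have "12 \<le> m" using assms 2 by simp
    have "Suc m ^ 3 * (48 * Suc m) \<le> (2 * m ^ 3) * (48 * Suc m)"
      using Suc_cube_le[of m] \<open>12 \<le> m\<close> by (intro mult_le_mono1) simp
    also have "\<dots> = m ^ 3 * (Suc m * (3 * (32 * 1)))" by simp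
    also have "\<dots> \<le> m ^ 3 * (Suc m * (3 * ((3 * m + 2) * (3 * m + 1))))"
      using \<open>12 \<le> m\<close> by (intro mult_le_mono2 mult_le_mono) auto
    finally have r: "Suc m ^ 3 * (48 * Suc m) \<le> m ^ 3 * (Suc m * (3 * ((3 * m + 2) * (3 * m + 1))))" .
    have "Suc m * b = Suc (Suc (Suc (3 * m)))" using 2 by simp
    hence e: "(fact (Suc m * b) :: nat) = (Suc m * (3 * ((3 * m + 2) * (3 * m + 1)))) * fact (3 * m)"
      by (simp only: fact_Suc of_nat_id) (simp add: algebra_simps)
    show ?thesis
    proof (rule blocks_bound_step[OF bb])
      show "(Suc m * (3 * ((3 * m + 2) * (3 * m + 1)))) * fact (m * b) \<le> (fact (Suc m * b) :: nat)"
        unfolding e using 2 by (simp only: mult.commute[of m 3])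
      show "Suc m ^ 3 * (2 ^ b * (fact b * Suc m)) \<le> m ^ 3 * (Suc m * (3 * ((3 * m + 2) * (3 * m + 1))))"
        using r 2 by (simp add: fact_numeral del: power_Suc mult_Suc mult_Suc_right)
    qed (use assms in simp)
  next
    case 3
    then obtain c where c: "b = 4 + c" using le_Suc_ex by blast
    have "2 ^ 4 * (Suc m ^ 4 * 2 ^ c) \<le> m ^ 3 * (Suc m ^ 4 * Suc m ^ c)"
    proof (rule mult_le_mono)
      have "3 ^ 3 \<le> m ^ 3" using assms by (intro power_mono) auto
      thus "2 ^ 4 \<le> m ^ 3" by simp
      have "(2::nat) ^ c \<le> Suc m ^ c" using assms by (intro power_mono) auto
      thus "Suc m ^ 4 * 2 ^ c \<le> Suc m ^ 4 * Suc m ^ c" by (rule mult_le_mono2)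
    qed
    hence "fact b * (2 ^ 4 * (Suc m ^ 4 * 2 ^ c)) \<le> fact b * (m ^ 3 * (Suc m ^ 4 * Suc m ^ c))"
      by (rule mult_le_mono2)
    moreover have "Suc m ^ 3 * (2 ^ b * (fact b * Suc m)) = fact b * (2 ^ 4 * (Suc m ^ 4 * 2 ^ c))"
      using power_Suc[of "Suc m" 3, symmetric] unfolding c power_add by (simp add: ac_simps del: power_Suc mult_Suc mult_Suc_right)
    moreover have "fact b * (m ^ 3 * (Suc m ^ 4 * Suc m ^ c)) = m ^ 3 * (Suc m ^ b * fact b)"
      unfolding c power_add by (simp only: ac_simps)
    ultimately have r: "Suc m ^ 3 * (2 ^ b * (fact b * Suc m)) \<le> m ^ 3 * (Suc m ^ b * fact b)"
      by simp
    show ?thesis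
    proof (rule blocks_bound_step[OF bb _ _ r])
      show "(Suc m ^ b * fact b) * fact (m * b) \<le> (fact (Suc m * b) :: nat)"
        using fact_add_ge[of b b m] by (simp add: algebra_simps)
    qed (use assms in simp)
  qed
qed

text \<open>The critical case. At b = 12 the two sides differ by less than a factor 2, and at b = 10
  the inequality is false.\<close>

lemma blocks_bound_three:
  assumes "12 \<le> b"
  shows "blocks_bound 3 b"
  using assms
proof (induction b rule: dec_induct)
  case base
  show ?case unfolding blocks_bound_def by (simp add: fact_numeral)
next
  case (step b)
  let ?L = "(3 * b) ^ 3 * 2 ^ (3 * b) * (fact b ^ 3 * fact 3)"
  have IH: "?L < 10 * fact (3 * b)" using step.IH unfolding blocks_bound_def .
  let ?F = "Suc b * (3 * ((3 * b + 2) * (3 * b + 1)))"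
  \<comment> \<open>In one step the left side grows by \<open>8 * Suc b ^ 3\<close> times the cube
    of (b + 1) / b, which is at most 2. After cancelling one factor \<open>Suc b\<close>, the new
    factors of \<open>fact (3 * Suc b)\<close> must therefore supply
    \<open>16 * Suc b ^ 2\<close>.\<close>
  have "8 * Suc b ^ 2 \<le> (3 * b + 2) * (3 * b + 1)"
  proof -
    obtain c where "b = 12 + c" using step.hyps le_Suc_ex by blast
    thus ?thesis by (simp add: power2_eq_square algebra_simps)
  qed
  hence "16 * Suc b ^ 2 \<le> 3 * ((3 * b + 2) * (3 * b + 1))" by linarith
  hence "b ^ 3 * (Suc b * (16 * Suc b ^ 2)) \<le> b ^ 3 * ?F" by (intro mult_le_mono2)
  moreover have "(8 * Suc b ^ 3) * Suc b ^ 3 \<le> (8 * Suc b ^ 3) * (2 * b ^ 3)"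
    using Suc_cube_le[of b] step.hyps by (intro mult_le_mono2) simp
  moreover have "(8 * Suc b ^ 3) * (2 * b ^ 3) = b ^ 3 * (Suc b * (16 * Suc b ^ 2))"
    using power_Suc[of "Suc b" 2] unfolding numeral_3_eq_3 numeral_2_eq_2
    by (simp only: ac_simps)
  ultimately have r: "8 * (Suc b ^ 3 * Suc b ^ 3) \<le> b ^ 3 * ?F" by (simp only: mult.assoc)
  have "3 * Suc b = Suc (Suc (Suc (3 * b)))" by simp
  hence e: "(fact (3 * Suc b) :: nat) = ?F * fact (3 * b)"
    by (simp only: fact_Suc of_nat_id) (simp add: algebra_simps)
  have p2: "(2 :: nat) ^ (3 * Suc b) = 8 * 2 ^ (3 * b)" by (simp add: power_add)
  have pf: "(fact (Suc b) :: nat) ^ 3 = Suc b ^ 3 * fact b ^ 3"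
    by (simp only: fact_Suc of_nat_id power_mult_distrib)
  have "b ^ 3 * ((3 * Suc b) ^ 3 * 2 ^ (3 * Suc b) * (fact (Suc b) ^ 3 * fact 3))
      = ?L * (8 * (Suc b ^ 3 * Suc b ^ 3))"
    unfolding p2 pf power_mult_distrib by (simp only: ac_simps)
  also have "\<dots> \<le> ?L * (b ^ 3 * ?F)" using r by (rule mult_le_mono2)
  also have "\<dots> < (10 * fact (3 * b)) * (b ^ 3 * ?F)" using IH step.hyps by simp
  also have "\<dots> = b ^ 3 * (10 * fact (3 * Suc b))" unfolding e by simp
  finally show ?case unfolding blocks_bound_def using step.hyps by simp
qed

lemma blocks_bound_from:
  assumes "m0 \<le> m" "blocks_bound m0 b" "3 \<le> m0" "2 \<le> b" "36 \<le> m0 * b"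
  shows "blocks_bound m b"
  using assms(1)
proof (induction m rule: dec_induct)
  case (step m)
  have "m0 * b \<le> m * b" using step by simp
  hence "36 \<le> m * b" using assms by linarith
  thus ?case using step assms by (intro blocks_bound_Suc) auto
qed (use assms in simp)

lemma blocks_bound:
  assumes "3 \<le> m" "2 \<le> b" "36 \<le> m * b"
  shows "blocks_bound m b"
proof (cases "12 \<le> b")
  case True
  show ?thesis using assms True by (intro blocks_bound_from[OF _ blocks_bound_three[OF True]]) auto
next
  case False
  \<comment> \<open>For each b below 12 this is the least m with 36 \<le> m * b; larger m follow by
    adding blocks.\<close>
  have base: "blocks_bound 18 2" "blocks_bound 12 3" "blocks_bound 9 4" "blocks_bound 8 5"
    "blocks_bound 6 6" "blocks_bound 6 7" "blocks_bound 5 8" "blocks_bound 4 9"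
    "blocks_bound 4 10" "blocks_bound 4 11"
    unfolding blocks_bound_def by (simp_all add: fact_numeral)
  have "b \<in> {2, 3, 4, 5, 6, 7, 8, 9, 10, 11}" using False assms(2) by (simp, presburger)
  then show ?thesis
    using assms base[THEN blocks_bound_from[rotated], of m] by auto
qed

section \<open>Binomial coefficients in the lower third of a row\<close>

lemma binomial_double_le:
  assumes "3 * i + 2 \<le> n"
  shows "2 * (n choose i) \<le> n choose Suc i"
proof -
  have "Suc i * (n choose Suc i) = (n - i) * (n choose i)"
    using binomial_absorption binomial_absorb_comp by simp
  moreover have "(2 * Suc i) * (n choose i) \<le> (n - i) * (n choose i)"
    using assms by (intro mult_le_mono1) auto
  ultimately have "Suc i * (2 * (n choose i)) \<le> Suc i * (n choose Suc i)" by (simp add: algebra_simps)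
  thus ?thesis by (simp only: Suc_mult_le_cancel1)
qed

text \<open>The entries at i, i + 1, i + 2 and their mirror images are distinct and contribute at
  least 2 * (1 + 2 + 2) times the first. The plain bound by \<open>2 ^ n\<close> would be too weak
  for three blocks of size 12.\<close>

lemma ten_binomial_le:
  assumes "3 * i + 3 \<le> n" "15 \<le> n"
  shows "10 * (n choose i) \<le> 2 ^ n"
proof -
  let ?I = "{i, i + 1, i + 2, n - i, n - (i + 1), n - (i + 2)}"
  have d: "2 * (n choose i) \<le> n choose (i + 1)" using binomial_double_le[of i n] assms by simp
  also have e: "\<dots> \<le> n choose (i + 2)" using assms by (intro binomial_mono) auto
  finally have f: "2 * (n choose i) \<le> n choose (i + 2)" .
  have s: "n choose (n - j) = n choose j" if "j \<le> n" for j
    using binomial_symmetric[OF that] by simp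
  have "10 * (n choose i) \<le> sum ((choose) n) ?I"
  proof -
    have "sum ((choose) n) ?I = sum ((choose) n) {i, i + 1, i + 2} + sum ((choose) n) ((-) n ` {i, i + 1, i + 2})"
      using assms by (subst sum.union_disjoint[symmetric]) (auto intro: sum.cong)
    also have "sum ((choose) n) ((-) n ` {i, i + 1, i + 2}) = (\<Sum>j\<in>{i, i + 1, i + 2}. n choose (n - j))"
      using assms by (subst sum.reindex) (auto simp: inj_on_def)
    also have "\<dots> = sum ((choose) n) {i, i + 1, i + 2}" using assms s by (intro sum.cong) auto
    finally show ?thesis using d f by simp
  qed
  also have "\<dots> \<le> sum ((choose) n) {..n}" using assms by (intro sum_mono2) auto
  also have "\<dots> = 2 ^ n" by (rule choose_row_sum)
  finally show ?thesis .
qed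

lemma sum_binomial_le:
  assumes "3 * s \<le> n + 1"
  shows "(\<Sum>i<s. n choose i) \<le> n choose s"
  using assms
proof (induction s)
  case (Suc s)
  have "2 * (n choose s) \<le> n choose Suc s" using Suc.prems by (intro binomial_double_le) auto
  thus ?case using Suc by simp
qed simp

text \<open>The coefficients 2 and 1 bound the number of j-sets fixed by a test element of level i <
  2 * k - 1 and i = 2 * k - 1. The whole sum is at most three times its top entry, hence at most 3/2
  of \<open>(6 * k) choose (2 * k)\<close>, and the next ratio of the row is 4 * k / (2 * k + 1) >
  3/2.\<close>

lemma weighted_binomial_sum_less:
  assumes "2 \<le> k" "2 * k < j" "j \<le> 3 * k"
  shows "(\<Sum>i<2 * k - 1. 2 * ((6 * k) choose i)) + ((6 * k) choose (2 * k - 1)) < (6 * k) choose j"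
proof -
  let ?n = "6 * k"
  let ?C = "?n choose (2 * k - 1)"
  have "(\<Sum>i<2 * k - 1. ?n choose i) \<le> ?C" using assms by (intro sum_binomial_le) auto
  hence "(\<Sum>i<2 * k - 1. 2 * (?n choose i)) + ?C \<le> 3 * ?C" by (simp add: sum_distrib_left[symmetric])
  also have "\<dots> < ?n choose (2 * k + 1)"
  proof -
    have "2 * ?C \<le> ?n choose Suc (2 * k - 1)" using assms by (intro binomial_double_le) auto
    hence a: "2 * ?C \<le> ?n choose (2 * k)" using assms by simp
    have pos: "0 < ?n choose (2 * k)" using assms by (simp add: zero_less_binomial_iff)
    have "Suc (2 * k) * (?n choose Suc (2 * k)) = (?n - 2 * k) * (?n choose (2 * k))"
      by (simp only: binomial_absorption binomial_absorb_comp)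
    hence b: "(2 * k + 1) * (?n choose (2 * k + 1)) = (4 * k) * (?n choose (2 * k))" by simp
    have "(2 * k + 1) * (2 * (3 * ?C)) \<le> (2 * k + 1) * (3 * (?n choose (2 * k)))"
      using a by (intro mult_le_mono2) simp
    also have "\<dots> = (6 * k + 3) * (?n choose (2 * k))" by (simp add: algebra_simps)
    also have "\<dots> < (8 * k) * (?n choose (2 * k))" using assms pos by (intro mult_less_mono1) auto
    also have "\<dots> = (2 * k + 1) * (2 * (?n choose (2 * k + 1)))" using b by simp
    finally have "2 * (3 * ?C) < 2 * (?n choose (2 * k + 1))" by (simp only: mult_less_cancel1)
    thus ?thesis by simp
  qed
  also have "\<dots> \<le> ?n choose j" using assms by (intro binomial_mono) auto
  finally show ?thesis .
qed

section \<open>Cycles of permutations\<close>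

definition cycles_on :: "('a \<Rightarrow> 'a) \<Rightarrow> 'a set \<Rightarrow> bool" where
  "cycles_on g X \<longleftrightarrow> g ` X = X \<and> (\<forall>x\<in>X. \<forall>y\<in>X. \<exists>m. (g ^^ m) x = y)"

lemma cycles_onD: "cycles_on g X \<Longrightarrow> x \<in> X \<Longrightarrow> y \<in> X \<Longrightarrow> \<exists>m. (g ^^ m) x = y"
  by (simp add: cycles_on_def)

lemma cycles_on_image: "cycles_on g X \<Longrightarrow> g ` X = X"
  by (simp add: cycles_on_def)

lemma funpow_image_in: "g ` X \<subseteq> X \<Longrightarrow> x \<in> X \<Longrightarrow> (g ^^ m) x \<in> X"
  by (induction m) auto

lemma funpow_cong_on:
  assumes "g ` X \<subseteq> X" "\<And>x. x \<in> X \<Longrightarrow> f x = g x" "x \<in> X"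
  shows "(f ^^ m) x = (g ^^ m) x"
proof (induction m)
  case (Suc m)
  thus ?case using assms(2)[OF funpow_image_in[OF assms(1,3), of m]] by simp
qed simp

lemma cycles_on_cong:
  assumes "\<And>x. x \<in> X \<Longrightarrow> f x = g x"
  shows "cycles_on f X \<longleftrightarrow> cycles_on g X"
proof -
  have "f ` X = g ` X" using assms by (rule image_cong[OF refl])
  thus ?thesis unfolding cycles_on_def using funpow_cong_on[of g X f] assms by auto
qed

lemma cycles_on_subset_or_disjoint:
  assumes "cycles_on g X" "g ` J = J"
  shows "X \<subseteq> J \<or> X \<inter> J = {}"
proof -
  have "y \<in> J" if "x \<in> X" "x \<in> J" "y \<in> X" for x y
  proof -
    from cycles_onD[OF assms(1) that(1,3)] obtain m where "(g ^^ m) x = y" ..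
    thus ?thesis using funpow_image_in[of g J x m] assms(2) that by simp
  qed
  thus ?thesis by blast
qed

lemma cycles_on_eq_or_disjoint:
  assumes "cycles_on g X" "cycles_on g Y"
  shows "X = Y \<or> X \<inter> Y = {}"
proof -
  have "g ` X = X" "g ` Y = Y" using assms unfolding cycles_on_def by simp_all
  thus ?thesis
    using cycles_on_subset_or_disjoint[OF assms(1)] cycles_on_subset_or_disjoint[OF assms(2)] by blast
qed

lemma funpow_conj:
  assumes "bij h"
  shows "((h \<circ> g \<circ> inv' h) ^^ m) (h x) = h ((g ^^ m) x)"
  by (induction m) (simp_all add: inv_f_f[OF bij_is_inj[OF assms]])

lemma image_conj:
  assumes "bij h"
  shows "(h \<circ> g \<circ> inv' h) ` (h ` X) = h ` (g ` X)"
  by (simp add: image_image inv_f_f[OF bij_is_inj[OF assms]])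

lemma cycles_on_conj:
  assumes "bij h" "cycles_on g X"
  shows "cycles_on (h \<circ> g \<circ> inv' h) (h ` X)"
proof -
  have "(h \<circ> g \<circ> inv' h) ` (h ` X) = h ` X"
    unfolding image_conj[OF assms(1)] using assms(2) by (simp add: cycles_on_def)
  moreover have "\<exists>m. ((h \<circ> g \<circ> inv' h) ^^ m) (h x) = h y" if "x \<in> X" "y \<in> X" for x y
  proof -
    from cycles_onD[OF assms(2) that] obtain m where "(g ^^ m) x = y" ..
    thus ?thesis using funpow_conj[OF assms(1), of m g x] by auto
  qed
  ultimately show ?thesis unfolding cycles_on_def by blast
qed

lemma cycles_on_exists:
  assumes "finite X"
  obtains g where "g permutes X" "cycles_on g X"
proof -
  obtain cs where cs: "set cs = X" "distinct cs" using finite_distinct_list[OF assms] by blast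
  let ?g = "cycle_of_list cs"
  have "\<exists>m. (?g ^^ m) x = y" if "x \<in> X" "y \<in> X" for x y
  proof -
    have "x \<in> set cs" "y \<in> set cs" using that cs(1) by auto
    then obtain i j where ij: "i < length cs" "x = cs ! i" "j < length cs" "y = cs ! j"
      unfolding in_set_conv_nth by blast
    \<comment> \<open>Rotating past the end of the list and then on to j keeps the exponent a
      natural number.\<close>
    let ?m = "length cs - i + j"
    have "(?g ^^ ?m) x = map (?g ^^ ?m) cs ! i" using ij by simp
    also have "\<dots> = rotate ?m cs ! i" by (simp only: cyclic_rotation[OF cs(2)])
    also have "\<dots> = cs ! ((?m + i) mod length cs)" using ij nth_rotate by blast
    also have "?m + i = length cs + j" using ij by simp
    finally show ?thesis using ij by auto
  qed
  moreover have "?g permutes X" using cycle_permutes[of cs] cs by simp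
  moreover have "?g ` X = X" using cycle_is_surj[OF cs(2)] cs by simp
  ultimately show thesis using that unfolding cycles_on_def by blast
qed

lemma cycles_on_support:
  assumes "permutation g"
  shows "cycles_on g (set (support g x))"
proof -
  let ?X = "range (\<lambda>i. (g ^^ i) x)"
  let ?p = "least_power g x"
  have p: "(g ^^ ?p) x = x" "0 < ?p" using least_power_of_permutation[OF assms] by auto
  have mult: "(g ^^ (i * ?p)) x = x" for i
    using least_power_dvd[OF assms, of x "i * ?p"] by simp
  \<comment> \<open>A multiple of the period that is at least i is added, so that
    \<open>i * ?p - i\<close> plays the role of the exponent -i.\<close>
  have reach: "(g ^^ (i * ?p - i + j)) ((g ^^ i) x) = (g ^^ j) x" for i j
  proof -
    have "i \<le> i * ?p" using p by simp
    hence "i * ?p - i + j + i = j + i * ?p" by linarith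
    thus ?thesis using mult by (metis comp_apply funpow_add)
  qed
  have "g ` ?X = ?X"
  proof
    show "g ` ?X \<subseteq> ?X"
    proof clarify
      fix i
      have "g ((g ^^ i) x) = (g ^^ Suc i) x" by simp
      thus "g ((g ^^ i) x) \<in> ?X" by blast
    qed
    show "?X \<subseteq> g ` ?X"
    proof clarify
      fix i
      have "(g ^^ i) x = (g ^^ (i + ?p)) x" using p by (simp add: funpow_add)
      also have "i + ?p = Suc (i + ?p - 1)" using p by simp
      finally have "(g ^^ i) x = g ((g ^^ (i + ?p - 1)) x)" by simp
      thus "(g ^^ i) x \<in> g ` ?X" by blast
    qed
  qed
  thus ?thesis unfolding support_set[OF assms] cycles_on_def using reach by blast
qed

lemma cycles_on_eq_support:
  assumes "permutation g" "cycles_on g X" "x \<in> X"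
  shows "X = set (support g x)"
proof -
  have "x \<in> set (support g x)"
    unfolding support_set[OF assms(1)] using funpow_0[of g x] by (metis rangeI)
  thus ?thesis
    using cycles_on_eq_or_disjoint[OF assms(2) cycles_on_support[OF assms(1)]] assms(3) by blast
qed

lemma card_cycles_on:
  assumes "permutation g" "cycles_on g X" "x \<in> X"
  shows "card X = least_power g x"
proof -
  have "card X = length (support g x)"
    using distinct_card[OF cycle_of_permutation[OF assms(1), of x]] cycles_on_eq_support[OF assms]
    by metis
  thus ?thesis by simp
qed

lemma evenperm_cycle_of_list:
  assumes "distinct cs" "cs \<noteq> []"
  shows "evenperm (cycle_of_list cs) \<longleftrightarrow> odd (length cs)"
  using assms
proof (induction cs rule: cycle_of_list.induct)
  case (1 i j cs)
  have "evenperm (cycle_of_list (i # j # cs)) \<longleftrightarrow>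
      evenperm (transpose i j) = evenperm (cycle_of_list (j # cs))"
    unfolding cycle_of_list.simps
    by (rule evenperm_comp[OF permutation_swap_id permutation_of_cycle])
  thus ?case using 1 by (simp add: evenperm_swap del: cycle_of_list.simps)
qed auto

lemma evenperm_cycles_on:
  assumes "finite X" "X \<noteq> {}" "g permutes X" "cycles_on g X"
  shows "evenperm g \<longleftrightarrow> odd (card X)"
proof -
  have perm: "permutation g" using assms permutation_permutes by blast
  obtain x where x: "x \<in> X" using assms by blast
  let ?s = "support g x"
  have X: "X = set ?s" by (rule cycles_on_eq_support[OF perm assms(4) x])
  have "g = cycle_of_list ?s"
  proof
    fix y
    show "g y = cycle_of_list ?s y"
    proof (cases "y \<in> X")
      case True
      thus ?thesis using cycle_restrict[OF perm] X by blast
    next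
      case False
      thus ?thesis using permutes_not_in[OF assms(3)] id_outside_supp[of y ?s] X by metis
    qed
  qed
  moreover have "distinct ?s" by (rule cycle_of_permutation[OF perm])
  moreover have "?s \<noteq> []" using X x by (metis empty_iff list.set(1))
  moreover have "length ?s = card X" using X distinct_card[OF \<open>distinct ?s\<close>] by metis
  ultimately show ?thesis using evenperm_cycle_of_list by metis
qed

text \<open>A cycle of length l has the parity of l - 1, so the total is the number of points minus
  the number of cycles.\<close>

lemma evenperm_iff_cycles:
  assumes "finite P" "finite (\<Union>P)" "pairwise disjnt P" "g permutes \<Union>P"
    "\<And>X. X \<in> P \<Longrightarrow> X \<noteq> {} \<and> cycles_on g X"
  shows "evenperm g \<longleftrightarrow> even (card (\<Union>P) + card P)"
  using assms
proof (induction P arbitrary: g rule: finite_induct)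
  case empty
  then show ?case by simp
next
  case (insert X P)
  let ?U = "\<Union>P"
  have "X \<inter> Y = {}" if "Y \<in> P" for Y
  proof -
    have "X \<noteq> Y" using that insert.hyps by blast
    thus ?thesis using insert.prems(2) that by (simp add: pairwise_insert disjnt_def)
  qed
  hence disj: "X \<inter> ?U = {}" by blast
  have fin: "finite X" "finite ?U" using insert.prems(1) by auto
  have cyc: "X \<noteq> {}" "cycles_on g X" using insert.prems(4) by auto
  have gX: "g ` X = X" using cyc(2) by (rule cycles_on_image)
  have gU: "g ` ?U = ?U" using insert.prems(4) by (simp add: image_Union cycles_on_image)
  have inj: "inj g" using insert.prems(3) by (rule permutes_inj)
  have bX: "bij_betw g X X" and bU: "bij_betw g ?U ?U"
    using gX gU inj by (auto simp: bij_betw_def intro: inj_on_subset)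
  let ?gX = "restrict_id g X" and ?gU = "restrict_id g ?U"
  have pX: "?gX permutes X" and pU: "?gU permutes ?U"
    using bX bU permutes_restrict_id by blast+
  have "g = ?gX \<circ> ?gU"
  proof
    fix x
    consider "x \<in> X" | "x \<in> ?U" | "x \<notin> X \<union> ?U" by blast
    then show "g x = (?gX \<circ> ?gU) x"
    proof cases
      case 1
      then have "x \<notin> ?U" using disj by blast
      then show ?thesis using 1 by simp
    next
      case 2
      then have "g x \<in> ?U" using gU by blast
      hence "g x \<notin> X" using disj by blast
      then show ?thesis using 2 by simp
    next
      case 3
      then have "g x = x" using permutes_not_in[OF insert.prems(3), of x] by simp
      then show ?thesis using 3 by simp
    qed
  qed
  hence "evenperm g \<longleftrightarrow> evenperm ?gX = evenperm ?gU"
    using evenperm_comp[of ?gX ?gU] pX pU fin permutation_permutes by metis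
  moreover have "evenperm ?gX \<longleftrightarrow> odd (card X)"
    using evenperm_cycles_on[OF fin(1) cyc(1) pX] cyc(2) cycles_on_cong[of X ?gX g] by simp
  moreover have "evenperm ?gU \<longleftrightarrow> even (card ?U + card P)"
  proof (rule insert.IH)
    show "pairwise disjnt P" using insert.prems(2) by (simp add: pairwise_insert)
    show "Y \<noteq> {} \<and> cycles_on ?gU Y" if "Y \<in> P" for Y
    proof -
      have "?gU x = g x" if "x \<in> Y" for x using that \<open>Y \<in> P\<close> by (intro restrict_id_simps) blast
      thus ?thesis using insert.prems(4)[of Y] that cycles_on_cong[of Y ?gU g] by simp
    qed
  qed (use pU fin in auto)
  moreover have "card (\<Union>(insert X P)) = card X + card ?U"
    using disj fin by (simp add: card_Un_disjoint)
  moreover have "card (insert X P) = Suc (card P)" using insert.hyps by simp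
  ultimately show ?case by auto
qed

text \<open>The even and the odd iterates of one point are the two colours; an even period keeps
  them disjoint.\<close>

lemma cycles_on_alternating:
  assumes "permutation g" "cycles_on g X" "even (card X)"
  obtains Y where "Y \<subseteq> X" "g ` Y = X - Y" "g ` (X - Y) = Y"
proof (cases "X = {}")
  case True
  then show ?thesis using that[of "{}"] by simp
next
  case False
  then obtain x where x: "x \<in> X" by blast
  let ?Y = "{(g ^^ m) x | m. even m}" and ?Z = "{(g ^^ m) x | m. odd m}"
  have X: "X = range (\<lambda>i. (g ^^ i) x)"
    using cycles_on_eq_support[OF assms(1,2) x] support_set[OF assms(1)] by simp
  have inj: "inj g" using assms(1) permutation_bijective bij_is_inj by blast
  have ev: "even m" if "(g ^^ m) x = x" for m
    using that least_power_dvd[OF assms(1), of x m] card_cycles_on[OF assms(1,2) x] assms(3)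
      dvd_trans by metis
  have par: "even i = even j" if "(g ^^ i) x = (g ^^ j) x" "i \<le> j" for i j
    using funpow_diff[OF inj that(2,1)] ev[of "j - i"] that(2) by auto
  have disj: "?Y \<inter> ?Z = {}"
  proof -
    have False if "(g ^^ i) x = (g ^^ j) x" "even i" "odd j" for i j
      using par[of i j] par[of j i] that by (metis nat_le_linear)
    thus ?thesis by auto
  qed
  have un: "X = ?Y \<union> ?Z" unfolding X by auto
  have sub: "g ` ?Y \<subseteq> ?Z"
  proof clarify
    fix m :: nat assume "even m"
    thus "\<exists>m'. g ((g ^^ m) x) = (g ^^ m') x \<and> odd m'" by (intro exI[of _ "Suc m"]) simp
  qed
  have sup: "?Z \<subseteq> g ` ?Y"
  proof clarify
    fix m :: nat assume m: "odd m"
    then obtain m' where m': "m = Suc m'" "even m'" by (cases m) auto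
    hence "(g ^^ m) x = g ((g ^^ m') x)" by simp
    thus "(g ^^ m) x \<in> g ` ?Y" using m' by blast
  qed
  have Y: "g ` ?Y = X - ?Y" using sub sup disj un by blast
  have "g ` (X - ?Y) = g ` X - g ` ?Y" using inj by (simp add: image_set_diff)
  also have "\<dots> = ?Y" unfolding cycles_on_image[OF assms(2)] Y using un by blast
  finally show ?thesis using that[of ?Y] Y un by blast
qed

text \<open>Inside X the points of B are exchanged with the others. Hence a permutation with an odd
  cycle cannot swap two halves.\<close>

lemma even_card_of_swapped:
  assumes "inj g" "finite X" "g ` X = X" "X \<subseteq> U" "g ` B = U - B"
  shows "even (card X)"
proof -
  have "g ` (X \<inter> B) = X \<inter> (U - B)" unfolding image_Int[OF assms(1)] assms(3,5) ..
  hence "g ` (X \<inter> B) = X - B" using assms(4) by blast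
  hence "card (X - B) = card (X \<inter> B)" using card_image inj_on_subset[OF assms(1)] by (metis subset_UNIV)
  moreover have "card X = card (X \<inter> B) + card (X - B)"
    using assms(2) by (metis card_Int_Diff)
  ultimately show ?thesis by simp
qed

text \<open>The identity h ((g ^^ m) r) = ((h g h^-1) ^^ m) (h r) shows that h is determined by its
  values on the base points R and by the conjugate. This replaces the orbit-stabilizer theorem with
  a bound on the centralizer.\<close>

lemma card_conjugates_ge:
  assumes fin: "finite S" and R: "R \<subseteq> S"
    and reach: "\<And>x. x \<in> S \<Longrightarrow> \<exists>r\<in>R. \<exists>m. (g ^^ m) r = x"
  shows "fact (card S) \<le> card S ^ card R * card ((\<lambda>h. h \<circ> g \<circ> inv' h) ` {h. h permutes S})"
proof -
  let ?H = "{h. h permutes S}" and ?c = "\<lambda>h. h \<circ> g \<circ> inv' h"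
  let ?\<phi> = "\<lambda>h. (restrict h R, ?c h)"
  have finR: "finite R" by (rule finite_subset[OF R fin])
  have finH: "finite ?H" using fin by (rule finite_permutations)
  have "inj_on ?\<phi> ?H"
  proof (rule inj_onI, clarsimp)
    fix h k assume h: "h permutes S" and k: "k permutes S"
      and r: "restrict h R = restrict k R" and c: "h \<circ> g \<circ> inv' h = k \<circ> g \<circ> inv' k"
    show "h = k"
    proof
      fix x
      show "h x = k x"
      proof (cases "x \<in> S")
        case True
        then obtain y m where y: "y \<in> R" "x = (g ^^ m) y" using reach by blast
        have "h y = k y" using r y by (metis restrict_apply')
        thus ?thesis
          using y funpow_conj[OF permutes_bij[OF h], where g = g and m = m and x = y]
            funpow_conj[OF permutes_bij[OF k], where g = g and m = m and x = y] c by simp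
      next
        case False
        thus ?thesis using permutes_not_in h k by metis
      qed
    qed
  qed
  moreover have "?\<phi> ` ?H \<subseteq> (R \<rightarrow>\<^sub>E S) \<times> ?c ` ?H"
    using R permutes_in_image by fastforce
  moreover have "finite ((R \<rightarrow>\<^sub>E S) \<times> ?c ` ?H)" using fin finR finH by (auto intro: finite_PiE)
  ultimately have "card ?H \<le> card ((R \<rightarrow>\<^sub>E S) \<times> ?c ` ?H)" by (rule card_inj_on_le)
  thus ?thesis
    using card_permutations[OF refl fin] finR by (simp add: card_cartesian_product card_PiE)
qed

lemma permutes_image_extend:
  assumes "finite S" "A \<subseteq> S" "B \<subseteq> S" "card A = card B"
  obtains h where "h permutes S" "h ` A = B"
proof -
  have fin: "finite A" "finite B" using assms finite_subset by auto
  obtain f where f: "bij_betw f A B" using finite_same_card_bij[OF fin assms(4)] by blast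
  have "card (S - A) = card (S - B)" using assms fin by (simp add: card_Diff_subset)
  then obtain f' where f': "bij_betw f' (S - A) (S - B)"
    using finite_same_card_bij assms(1) by blast
  let ?h = "\<lambda>x. if x \<in> A then f x else if x \<in> S then f' x else x"
  have 1: "bij_betw ?h A B" using f by (rule bij_betw_cong[THEN iffD1, rotated]) simp
  have 2: "bij_betw ?h (S - A) (S - B)" using f' by (rule bij_betw_cong[THEN iffD1, rotated]) simp
  have "bij_betw ?h (A \<union> (S - A)) (B \<union> (S - B))" by (rule bij_betw_combine[OF 1 2]) blast
  moreover have "A \<union> (S - A) = S" "B \<union> (S - B) = S" using assms by auto
  ultimately have "bij_betw ?h S S" by simp
  hence "?h permutes S" using assms(2) by (intro bij_imp_permutes) auto
  moreover have "?h ` A = B" using 1 by (simp add: bij_betw_def)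
  ultimately show thesis using that by blast
qed

text \<open>An invariant set is a union of cycles. This reduces later questions about sets fixed by
  a test element with three cycles to comparing eight cardinalities.\<close>

lemma invariant_union:
  assumes "cycles_on g A" "cycles_on g X" "cycles_on g Y" "g ` J = J" "J \<subseteq> A \<union> X \<union> Y"
  shows "J \<in> {{}, A, X, Y, A \<union> X, A \<union> Y, X \<union> Y, A \<union> X \<union> Y}"
proof -
  have "A \<subseteq> J \<or> A \<inter> J = {}" "X \<subseteq> J \<or> X \<inter> J = {}" "Y \<subseteq> J \<or> Y \<inter> J = {}"
    using assms cycles_on_subset_or_disjoint by blast+
  hence "J = (if A \<subseteq> J then A else {}) \<union> (if X \<subseteq> J then X else {}) \<union> (if Y \<subseteq> J then Y else {})"
    using assms(5) by auto
  thus ?thesis by (auto split: if_splits)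
qed

lemma partition_stabilizer_iff:
  assumes "B \<subseteq> {1..m}"
  shows "g \<in> partition_stabilizer m B \<longleftrightarrow> g permutes {1..m} \<and> (g ` B = B \<or> g ` B = {1..m} - B)"
proof (cases "g permutes {1..m}")
  case True
  have "g ` ({1..m} - B) = {1..m} - g ` B"
    using image_set_diff[OF permutes_inj[OF True]] permutes_image[OF True] by simp
  moreover have "g ` B \<subseteq> {1..m}" using permutes_image[OF True] assms by blast
  ultimately show ?thesis
    unfolding partition_stabilizer_def sym_group_carrier using assms True
    by (auto simp: doubleton_eq_iff)
qed (simp add: partition_stabilizer_def sym_group_carrier)

lemma set_stabilizer_iff: "g \<in> set_stabilizer m A \<longleftrightarrow> g permutes {1..m} \<and> g ` A = A"
  unfolding set_stabilizer_def sym_group_carrier by simp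

lemma partition_stabilizer_complement:
  assumes "B \<subseteq> {1..m}"
  shows "partition_stabilizer m ({1..m} - B) = partition_stabilizer m B"
proof -
  have "{1..m} - ({1..m} - B) = B" using assms by blast
  thus ?thesis unfolding partition_stabilizer_def by (simp add: insert_commute)
qed

section \<open>Weights of covers\<close>

text \<open>The sum runs over members rather than test elements, so the lower bound for an arbitrary
  cover is a mere exchange of summation.\<close>

definition cover_weight :: "'a set set \<Rightarrow> 'a set \<Rightarrow> 'a set \<Rightarrow> real" where
  "cover_weight C P M = (\<Sum>H\<in>C. real (card (M \<inter> (H \<inter> P))) / real (card (H \<inter> P)))"

lemma cover_weight_member:
  assumes "finite C" "finite P" "H \<in> C" "H \<inter> P \<noteq> {}"
    and uni: "\<And>H' x. H' \<in> C \<Longrightarrow> x \<in> P \<Longrightarrow> x \<in> H \<Longrightarrow> x \<in> H' \<Longrightarrow> H' = H"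
  shows "cover_weight C P H = 1"
proof -
  have "H \<inter> (H' \<inter> P) = (if H' = H then H \<inter> P else {})" if "H' \<in> C" for H'
    using uni[OF that] by auto
  hence "cover_weight C P H
      = (\<Sum>H'\<in>C. if H' = H then real (card (H \<inter> P)) / real (card (H \<inter> P)) else 0)"
    unfolding cover_weight_def by (intro sum.cong) auto
  also have "\<dots> = real (card (H \<inter> P)) / real (card (H \<inter> P))" using assms by simp
  also have "\<dots> = 1" using assms by simp
  finally show ?thesis .
qed

lemma cover_weight_mono:
  assumes "finite P" "M \<subseteq> M'"
  shows "cover_weight C P M \<le> cover_weight C P M'"
  unfolding cover_weight_def
proof (intro sum_mono divide_right_mono)
  fix H
  have "card (M \<inter> (H \<inter> P)) \<le> card (M' \<inter> (H \<inter> P))" using assms by (intro card_mono) auto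
  thus "real (card (M \<inter> (H \<inter> P))) \<le> real (card (M' \<inter> (H \<inter> P)))" by simp
qed simp

text \<open>Every member has at least \<open>card M + 1\<close> test elements, so each of the at
  most \<open>card M\<close> test elements in M weighs no more than 1 / (\<open>card M\<close> +
  1).\<close>

lemma cover_weight_small:
  assumes "finite C" "finite M"
    and uni: "\<And>H H' x. H \<in> C \<Longrightarrow> H' \<in> C \<Longrightarrow> x \<in> P \<Longrightarrow> x \<in> H \<Longrightarrow> x \<in> H' \<Longrightarrow> H = H'"
    and small: "\<And>H. H \<in> C \<Longrightarrow> card M < card (H \<inter> P)"
  shows "cover_weight C P M < 1"
proof -
  have "cover_weight C P M \<le> (\<Sum>H\<in>C. real (card (M \<inter> (H \<inter> P))) / real (card M + 1))"
    unfolding cover_weight_def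
  proof (rule sum_mono)
    fix H assume "H \<in> C"
    hence "card M + 1 \<le> card (H \<inter> P)" using small by fastforce
    hence "real (card M + 1) \<le> real (card (H \<inter> P))" by (simp only: of_nat_le_iff)
    thus "real (card (M \<inter> (H \<inter> P))) / real (card (H \<inter> P)) \<le> real (card (M \<inter> (H \<inter> P))) / real (card M + 1)"
      by (intro divide_left_mono) auto
  qed
  also have "\<dots> = real (\<Sum>H\<in>C. card (M \<inter> (H \<inter> P))) / real (card M + 1)"
    by (simp add: sum_divide_distrib)
  also have "(\<Sum>H\<in>C. card (M \<inter> (H \<inter> P))) = card (\<Union>H\<in>C. M \<inter> (H \<inter> P))"
    using assms by (intro card_UN_disjoint[symmetric]) auto
  also have "real \<dots> / real (card M + 1) < 1"
  proof -
    have "card (\<Union>H\<in>C. M \<inter> (H \<inter> P)) \<le> card M" using assms by (intro card_mono) auto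
    thus ?thesis by simp
  qed
  finally show ?thesis .
qed

text \<open>The sets in D jointly cover the test elements of each member H, so their shares of H add
  up to at least 1.\<close>

lemma card_le_sum_cover_weight:
  assumes "finite C" "finite P" "\<And>H. H \<in> C \<Longrightarrow> H \<inter> P \<noteq> {}" "finite D" "P \<subseteq> \<Union>D"
  shows "real (card C) \<le> (\<Sum>M\<in>D. cover_weight C P M)"
proof -
  have "real (card C) = (\<Sum>H\<in>C. 1)" by simp
  also have "\<dots> \<le> (\<Sum>H\<in>C. \<Sum>M\<in>D. real (card (M \<inter> (H \<inter> P))) / real (card (H \<inter> P)))"
  proof (rule sum_mono)
    fix H assume H: "H \<in> C"
    have pos: "0 < card (H \<inter> P)" using assms H by (simp add: card_gt_0_iff)
    have "H \<inter> P = (\<Union>M\<in>D. M \<inter> (H \<inter> P))" using assms(5) by blast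
    hence "card (H \<inter> P) \<le> (\<Sum>M\<in>D. card (M \<inter> (H \<inter> P)))" using card_UN_le[OF assms(4)] by metis
    hence "real (card (H \<inter> P)) \<le> (\<Sum>M\<in>D. real (card (M \<inter> (H \<inter> P))))"
      by (metis of_nat_le_iff of_nat_sum)
    thus "1 \<le> (\<Sum>M\<in>D. real (card (M \<inter> (H \<inter> P))) / real (card (H \<inter> P)))"
      using pos by (simp add: sum_divide_distrib[symmetric])
  qed
  also have "\<dots> = (\<Sum>M\<in>D. cover_weight C P M)" unfolding cover_weight_def by (rule sum.swap)
  finally show ?thesis .
qed

text \<open>The strictness in \<open>key\<close> yields more than minimality: it makes every member
  of C maximal and excludes any other cover of the same size by maximal subgroups.\<close>

theorem definitely_unbeatable:
  assumes C: "is_cover G C" and P: "finite P" "P \<subseteq> carrier G"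
    and uni: "\<And>H H' x. H \<in> C \<Longrightarrow> H' \<in> C \<Longrightarrow> x \<in> P \<Longrightarrow> x \<in> H \<Longrightarrow> x \<in> H' \<Longrightarrow> H = H'"
    and ne: "\<And>H. H \<in> C \<Longrightarrow> H \<inter> P \<noteq> {}"
    and key: "\<And>M. subgroup M G \<Longrightarrow> M \<noteq> carrier G \<Longrightarrow> (\<exists>H\<in>C. M \<subseteq> H) \<or> cover_weight C P M < 1"
  shows "covering_number G = card C"
    and "is_cover G D \<and> card D = card C \<and> (\<forall>H\<in>D. maximal_subgroup H G) \<longleftrightarrow> D = C"
proof -
  have finC: "finite C" and subC: "\<And>H. H \<in> C \<Longrightarrow> subgroup H G \<and> H \<noteq> carrier G"
    using C unfolding is_cover_def by auto
  have w1: "cover_weight C P H = 1" if "H \<in> C" for H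
    using cover_weight_member[OF finC P(1) that ne[OF that]] uni that by metis
  have wle: "cover_weight C P M \<le> 1" if "subgroup M G" "M \<noteq> carrier G" for M
    using key[OF that] cover_weight_mono[OF P(1)] w1 by (metis less_eq_real_def)
  have lower: "real (card C) \<le> (\<Sum>M\<in>E. cover_weight C P M)" if "is_cover G E" for E
    using that P(2) unfolding is_cover_def
    by (intro card_le_sum_cover_weight[OF finC P(1) ne]) auto
  have wleE: "cover_weight C P M \<le> 1" if "is_cover G E" "M \<in> E" for E M
    using that wle unfolding is_cover_def by blast
  have "card C \<le> card E" if "is_cover G E" for E
  proof -
    have "(\<Sum>M\<in>E. cover_weight C P M) \<le> (\<Sum>M\<in>E. 1)" using wleE[OF that] by (rule sum_mono)
    hence "real (card C) \<le> real (card E)" using lower[OF that] by simp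
    thus ?thesis by simp
  qed
  thus "covering_number G = card C"
    unfolding covering_number_def using C by (intro Least_equality) blast+
  have max: "maximal_subgroup H G" if H: "H \<in> C" for H
    unfolding maximal_subgroup_def
  proof (intro conjI allI impI)
    fix K assume K: "subgroup K G \<and> H \<subseteq> K"
    show "K = H \<or> K = carrier G"
    proof (rule disjCI)
      assume nc: "K \<noteq> carrier G"
      \<comment> \<open>K inherits weight 1 from H, so \<open>key\<close> puts it inside some
        member; a test element of H lies in both members and identifies them.\<close>
      have "1 \<le> cover_weight C P K" using cover_weight_mono[OF P(1), of H K C] w1[OF H] K by simp
      then obtain H' where H': "H' \<in> C" "K \<subseteq> H'" using key[of K] K nc by force
      obtain x where "x \<in> H" "x \<in> P" using ne[OF H] by blast
      hence "H = H'" using uni[OF H H'(1)] K H' by blast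
      thus "K = H" using K H' by blast
    qed
  qed (use subC[OF H] in auto)
  show "is_cover G D \<and> card D = card C \<and> (\<forall>H\<in>D. maximal_subgroup H G) \<longleftrightarrow> D = C"
  proof
    assume D: "is_cover G D \<and> card D = card C \<and> (\<forall>H\<in>D. maximal_subgroup H G)"
    hence finD: "finite D" unfolding is_cover_def by blast
    have "M \<in> C" if M: "M \<in> D" for M
    proof -
      have maxM: "maximal_subgroup M G" using D M by blast
      hence sM: "subgroup M G" "M \<noteq> carrier G" unfolding maximal_subgroup_def by auto
      have "\<not> cover_weight C P M < 1"
      proof
        assume less: "cover_weight C P M < 1"
        \<comment> \<open>A single weight below 1 would pull the total below \<open>card D\<close>,
          which equals \<open>card C\<close>.\<close>
        have "(\<Sum>M\<in>D. cover_weight C P M) < (\<Sum>M\<in>D. 1)"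
          using sum_strict_mono_ex1[OF finD, of "cover_weight C P" "\<lambda>_. 1"] wleE D M less by blast
        thus False using lower[of D] D by simp
      qed
      then obtain H where "H \<in> C" "M \<subseteq> H" using key[OF sM] by blast
      moreover have "H = M"
        using maxM subC[OF \<open>H \<in> C\<close>] \<open>M \<subseteq> H\<close> unfolding maximal_subgroup_def by blast
      ultimately show ?thesis by simp
    qed
    hence "D \<subseteq> C" by blast
    thus "D = C" using D finC card_subset_eq by blast
  next
    assume "D = C"
    thus "is_cover G D \<and> card D = card C \<and> (\<forall>H\<in>D. maximal_subgroup H G)" using C max by simp
  qed
qed

lemma inj_conj:
  assumes "bij h"
  shows "inj (\<lambda>g. h \<circ> g \<circ> inv' h)"
proof (rule injI)
  fix f g assume e: "h \<circ> f \<circ> inv' h = h \<circ> g \<circ> inv' h"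
  have "h (f x) = h (g x)" for x
    using fun_cong[OF e, of "h x"] by (simp add: inv_f_f[OF bij_is_inj[OF assms]])
  thus "f = g" using bij_is_inj[OF assms] by (auto simp: inj_eq)
qed

section \<open>Test permutations\<close>

locale degree_six =
  fixes k n :: nat
  assumes k: "6 \<le> k" and n: "n = 6 * k"
begin

abbreviation \<Omega> :: "nat set" where "\<Omega> \<equiv> {1..n}"

definition low_sets :: "nat set set" where "low_sets = {A. A \<subseteq> \<Omega> \<and> card A \<le> 2 * k - 1}"

definition half_sets :: "nat set set" where "half_sets = {B. B \<subseteq> \<Omega> \<and> card B = 3 * k}"

text \<open>The length of one of the two long cycles accompanying a cycle of length \<open>i\<close>. The values are
  chosen so that no union of cycles has \<open>n div 2\<close> points and not all cycle lengths are even.\<close>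

definition long_length :: "nat \<Rightarrow> nat" where
  "long_length i = (if i = k - 1 then 2 * k + 3 else 2 * k + 1)"

definition witnesses :: "nat set \<Rightarrow> (nat \<Rightarrow> nat) set" where
  "witnesses A = {g. g permutes \<Omega> \<and> cycles_on g A \<and>
     (\<exists>X \<subseteq> \<Omega> - A. card X = long_length (card A) \<and> cycles_on g X \<and> cycles_on g (\<Omega> - A - X))}"

definition full_cycles :: "(nat \<Rightarrow> nat) set" where
  "full_cycles = {g. g permutes \<Omega> \<and> cycles_on g \<Omega>}"

text \<open>Attaching the alternating group to the empty set makes it the term i = 0 of the binomial
  sum and lets all levels be treated alike.\<close>

definition component :: "nat set \<Rightarrow> (nat \<Rightarrow> nat) set" where
  "component A = (if A = {} then carrier (alt_group n) else set_stabilizer n A)"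

text \<open>With length 2 * k + 1 the third cycle has 3 * k points exactly when i = k - 1; there 2 *
  k + 3 is taken instead, which is odd as well. For i = 2 * k - 1 the remaining 4 * k + 1 points
  split into two lengths of at least 2 * k only as 2 * k + 1 and 2 * k, hence the special
  clauses.\<close>

lemma long_length_arith:
  assumes "i \<le> 2 * k - 1"
  shows "2 * k + 1 \<le> long_length i" "2 * k \<le> n - i - long_length i"
    "i + long_length i + (n - i - long_length i) = n"
    "long_length i \<noteq> 3 * k" "n - i - long_length i \<noteq> 3 * k"
    "even i \<Longrightarrow> odd (long_length i)"
    "i < 2 * k - 1 \<Longrightarrow> 2 * k + 1 \<le> n - i - long_length i"
    "i = 2 * k - 1 \<Longrightarrow> long_length i = 2 * k + 1" "i = 2 * k - 1 \<Longrightarrow> n - i - long_length i = 2 * k"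
  using assms k n unfolding long_length_def by (auto split: if_splits)

lemma low_set_finite: "A \<in> low_sets \<Longrightarrow> finite A"
  unfolding low_sets_def using finite_subset by blast

lemma witnessesE:
  assumes "g \<in> witnesses A" "A \<in> low_sets"
  obtains X Y where "g permutes \<Omega>" "cycles_on g A" "cycles_on g X" "cycles_on g Y"
    "A \<union> X \<union> Y = \<Omega>" "A \<inter> X = {}" "A \<inter> Y = {}" "X \<inter> Y = {}"
    "card X = long_length (card A)" "card Y = n - card A - long_length (card A)"
    "finite A" "finite X" "finite Y"
proof -
  obtain X where X: "X \<subseteq> \<Omega> - A" "card X = long_length (card A)" "cycles_on g X"
      "cycles_on g (\<Omega> - A - X)" and g: "g permutes \<Omega>" "cycles_on g A"
    using assms(1) unfolding witnesses_def by auto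
  have A: "A \<subseteq> \<Omega>" using assms(2) unfolding low_sets_def by simp
  have "X \<subseteq> \<Omega>" using X(1) by blast
  hence fin: "finite A" "finite X" using A finite_subset[of _ \<Omega>] by simp_all
  have "card (\<Omega> - A) = n - card A" using A fin by (simp add: card_Diff_subset)
  hence "card (\<Omega> - A - X) = n - card A - long_length (card A)"
    using X fin by (simp add: card_Diff_subset)
  moreover have "A \<union> X \<union> (\<Omega> - A - X) = \<Omega>" using A X by blast
  ultimately show thesis using X g fin by (intro that[of X "\<Omega> - A - X"]) auto
qed

lemma witnesses_long_cycles:
  assumes "g \<in> witnesses A" "A \<in> low_sets"
  obtains X Y where "g permutes \<Omega>" "cycles_on g A" "cycles_on g X" "cycles_on g Y"
    "A \<union> X \<union> Y = \<Omega>" "A \<inter> X = {}" "A \<inter> Y = {}" "X \<inter> Y = {}"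
    "finite A" "finite X" "finite Y" "card A \<le> 2 * k - 1" "card A + card X + card Y = n"
    "2 * k + 1 \<le> card X" "2 * k \<le> card Y" "card X \<noteq> 3 * k" "card Y \<noteq> 3 * k"
    "even (card A) \<longrightarrow> odd (card X)"
    "card A < 2 * k - 1 \<longrightarrow> 2 * k + 1 \<le> card Y"
    "card A = 2 * k - 1 \<longrightarrow> card X = 2 * k + 1 \<and> card Y = 2 * k"
proof (rule witnessesE[OF assms])
  fix X Y
  have c: "card A \<le> 2 * k - 1" using assms(2) unfolding low_sets_def by simp
  assume "g permutes \<Omega>" "cycles_on g A" "cycles_on g X" "cycles_on g Y"
    "A \<union> X \<union> Y = \<Omega>" "A \<inter> X = {}" "A \<inter> Y = {}" "X \<inter> Y = {}"
    "card X = long_length (card A)" "card Y = n - card A - long_length (card A)"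
    "finite A" "finite X" "finite Y"
  thus thesis using long_length_arith[OF c] c by (intro that[of X Y]) simp_all
qed

text \<open>Since n is even, the parity is that of the number of cycles: two for the empty set,
  three otherwise.\<close>

lemma witnesses_evenperm:
  assumes "g \<in> witnesses A" "A \<in> low_sets"
  shows "evenperm g \<longleftrightarrow> A = {}"
proof (rule witnesses_long_cycles[OF assms])
  fix X Y
  assume h: "g permutes \<Omega>" "cycles_on g A" "cycles_on g X" "cycles_on g Y"
    "A \<union> X \<union> Y = \<Omega>" "A \<inter> X = {}" "A \<inter> Y = {}" "X \<inter> Y = {}"
    "finite A" "finite X" "finite Y"
    and c: "2 * k + 1 \<le> card X" "2 * k \<le> card Y"
  have ne: "X \<noteq> {}" "Y \<noteq> {}" "X \<noteq> Y" using c k h by auto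
  show ?thesis
  proof (cases "A = {}")
    case True
    let ?P = "{X, Y}"
    have U: "\<Union>?P = \<Omega>" using h True by auto
    have "evenperm g \<longleftrightarrow> even (card (\<Union>?P) + card ?P)"
    proof (rule evenperm_iff_cycles)
      show "g permutes \<Union>?P" using U h(1) by simp
      show "pairwise disjnt ?P" using h by (auto simp: pairwise_def disjnt_def)
      show "finite (\<Union>?P)" using U by simp
    qed (use h ne in auto)
    moreover have "card (\<Union>?P) = 6 * k" "card ?P = 2" using U n ne by simp_all
    ultimately show ?thesis using True by simp
  next
    case False
    let ?P = "{A, X, Y}"
    have U: "\<Union>?P = \<Omega>" using h by auto
    have neA: "A \<noteq> X" "A \<noteq> Y" using False h by auto
    have "evenperm g \<longleftrightarrow> even (card (\<Union>?P) + card ?P)"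
    proof (rule evenperm_iff_cycles)
      show "g permutes \<Union>?P" using U h(1) by simp
      show "pairwise disjnt ?P" using h by (auto simp: pairwise_def disjnt_def)
      show "finite (\<Union>?P)" using U by simp
    qed (use h ne False in auto)
    moreover have "card (\<Union>?P) = 6 * k" "card ?P = 3" using U n ne neA by simp_all
    ultimately show ?thesis using False by simp
  qed
qed

lemma full_cycle_odd:
  assumes "g \<in> full_cycles"
  shows "\<not> evenperm g"
proof -
  have "evenperm g \<longleftrightarrow> odd (card \<Omega>)"
    using assms k n unfolding full_cycles_def by (intro evenperm_cycles_on) auto
  thus ?thesis using n by simp
qed

lemma full_cycle_invariant:
  assumes "g \<in> full_cycles" "g ` J = J" "J \<subseteq> \<Omega>"
  shows "J = {} \<or> J = \<Omega>"
proof -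
  have "cycles_on g \<Omega>" using assms(1) unfolding full_cycles_def by simp
  from cycles_on_subset_or_disjoint[OF this assms(2)] show ?thesis using assms(3) by blast
qed

text \<open>Both long cycles have more points than any low set, so only A itself fits into
  one.\<close>

lemma witnesses_invariant_low:
  assumes "g \<in> witnesses A" "A \<in> low_sets" "A' \<in> low_sets" "A' \<noteq> {}" "g ` A' = A'"
  shows "A' = A"
proof (rule witnesses_long_cycles[OF assms(1,2)])
  fix X Y
  assume h: "cycles_on g A" "cycles_on g X" "cycles_on g Y" "A \<union> X \<union> Y = \<Omega>"
     "finite A" "finite X" "finite Y" and c: "2 * k + 1 \<le> card X" "2 * k \<le> card Y"
  have A': "A' \<subseteq> \<Omega>" "card A' \<le> 2 * k - 1" using assms(3) unfolding low_sets_def by auto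
  have fin: "finite A'" using low_set_finite[OF assms(3)] .
  have "A' \<in> {{}, A, X, Y, A \<union> X, A \<union> Y, X \<union> Y, A \<union> X \<union> Y}"
    using invariant_union[OF h(1-3) assms(5)] A' h(4) by simp
  moreover have "\<not> X \<subseteq> A'" "\<not> Y \<subseteq> A'"
    using card_mono[OF fin, of X] card_mono[OF fin, of Y] c A' k by linarith+
  ultimately show ?thesis using assms(4) by blast
qed

text \<open>Swapping the halves would need all cycles to be even, but A or X is odd. Fixing them
  would need a union of cycles with 3 * k points, and then, passing to the complement if necessary,
  a single cycle of that length.\<close>

lemma witnesses_not_partition_stabilizer:
  assumes "g \<in> witnesses A" "A \<in> low_sets" "B \<in> half_sets"
  shows "g \<notin> partition_stabilizer n B"
proof (rule witnesses_long_cycles[OF assms(1,2)], rule notI)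
  fix X Y
  assume g: "g permutes \<Omega>" and h: "cycles_on g A" "cycles_on g X" "cycles_on g Y"
    and U: "A \<union> X \<union> Y = \<Omega>" and disj: "A \<inter> X = {}" "A \<inter> Y = {}" "X \<inter> Y = {}"
    and fin: "finite A" "finite X" "finite Y"
    and c: "card A \<le> 2 * k - 1" "card A + card X + card Y = n"
    "2 * k + 1 \<le> card X" "2 * k \<le> card Y" "card X \<noteq> 3 * k" "card Y \<noteq> 3 * k"
    "even (card A) \<longrightarrow> odd (card X)"
    and ps: "g \<in> partition_stabilizer n B"
  have B: "B \<subseteq> \<Omega>" "card B = 3 * k" using assms(3) unfolding half_sets_def by auto
  have inj: "inj g" using g by (rule permutes_inj)
  have "g ` B \<noteq> \<Omega> - B"
  proof
    assume s: "g ` B = \<Omega> - B"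
    have "even (card A)" "even (card X)"
      using even_card_of_swapped[OF inj fin(1) cycles_on_image[OF h(1)] _ s]
        even_card_of_swapped[OF inj fin(2) cycles_on_image[OF h(2)] _ s] U by blast+
    thus False using c by blast
  qed
  hence "g ` B = B" using ps partition_stabilizer_iff[OF B(1)] by blast
  hence "B \<in> {{}, A, X, Y, A \<union> X, A \<union> Y, X \<union> Y, A \<union> X \<union> Y}"
    using invariant_union[OF h] B U by simp
  moreover have "card (A \<union> X) = card A + card X" "card (A \<union> Y) = card A + card Y"
    "card (X \<union> Y) = card X + card Y" "card (A \<union> X \<union> Y) = 6 * k"
    using disj fin U n by (simp_all add: card_Un_disjoint)
  ultimately show False using B(2) c n k by auto
qed

text \<open>An n-cycle flips membership in B and in B' at every step, so agreement of B and B' at a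
  point is constant along the cycle.\<close>

lemma full_cycle_partition_unique:
  assumes "g \<in> full_cycles" "B \<in> half_sets" "B' \<in> half_sets"
    "g \<in> partition_stabilizer n B" "g \<in> partition_stabilizer n B'"
  shows "B' = B \<or> B' = \<Omega> - B"
proof -
  have g: "g permutes \<Omega>" "cycles_on g \<Omega>" using assms(1) unfolding full_cycles_def by auto
  have swap: "g ` D = \<Omega> - D" if "D \<in> half_sets" "g \<in> partition_stabilizer n D" for D
  proof -
    have D: "D \<subseteq> \<Omega>" "card D = 3 * k" using that unfolding half_sets_def by auto
    hence "D \<noteq> {}" "D \<noteq> \<Omega>" using k n by auto
    hence "g ` D \<noteq> D" using full_cycle_invariant[OF assms(1) _ D(1)] by blast
    thus ?thesis using that(2) partition_stabilizer_iff[OF D(1)] by blast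
  qed
  have flip: "g x \<in> D \<longleftrightarrow> x \<notin> D" if "g ` D = \<Omega> - D" "x \<in> \<Omega>" for D x
  proof -
    have "g x \<in> \<Omega>" using permutes_in_image[OF g(1)] that(2) by simp
    moreover have "g x \<in> g ` D \<longleftrightarrow> x \<in> D" using permutes_inj[OF g(1)] by (simp add: inj_image_mem_iff)
    ultimately show ?thesis using that(1) by blast
  qed
  have step: "(g x \<in> B \<longleftrightarrow> g x \<in> B') \<longleftrightarrow> (x \<in> B \<longleftrightarrow> x \<in> B')" if "x \<in> \<Omega>" for x
    using flip[OF swap[OF assms(2,4)] that] flip[OF swap[OF assms(3,5)] that] by blast
  have pow: "((g ^^ m) x \<in> B \<longleftrightarrow> (g ^^ m) x \<in> B') \<longleftrightarrow> (x \<in> B \<longleftrightarrow> x \<in> B')" if "x \<in> \<Omega>" for m x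
  proof (induction m)
    case (Suc m)
    have "(g ^^ m) x \<in> \<Omega>" using funpow_image_in[of g \<Omega> x m] permutes_image[OF g(1)] that by simp
    thus ?case using Suc step by simp
  qed simp
  have one: "1 \<in> \<Omega>" using k n by simp
  have all: "(y \<in> B \<longleftrightarrow> y \<in> B') \<longleftrightarrow> (1 \<in> B \<longleftrightarrow> 1 \<in> B')" if "y \<in> \<Omega>" for y
  proof -
    from cycles_onD[OF g(2) one that] obtain m where "(g ^^ m) 1 = y" ..
    thus ?thesis using pow[OF one, of m] by simp
  qed
  have "B \<subseteq> \<Omega>" "B' \<subseteq> \<Omega>" using assms unfolding half_sets_def by auto
  thus ?thesis using all by (cases "1 \<in> B \<longleftrightarrow> 1 \<in> B'") blast+
qed

lemma alternating_partition:
  assumes g: "g permutes \<Omega>" and "finite P" "\<Union>P = \<Omega>" "pairwise disjnt P"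
    and P: "\<And>X. X \<in> P \<Longrightarrow> cycles_on g X \<and> even (card X)"
  obtains B where "B \<in> half_sets" "g \<in> partition_stabilizer n B"
proof -
  have perm: "permutation g" using g permutation_permutes by blast
  have "\<forall>X\<in>P. \<exists>Y. Y \<subseteq> X \<and> g ` Y = X - Y" using cycles_on_alternating[OF perm] P by metis
  then obtain f where f: "\<And>X. X \<in> P \<Longrightarrow> f X \<subseteq> X \<and> g ` f X = X - f X" by metis
  let ?B = "\<Union>X\<in>P. f X"
  have sub: "?B \<subseteq> \<Omega>" using f assms(3) by blast
  have "g ` ?B = (\<Union>X\<in>P. X - f X)" using f by (simp add: image_UN)
  also have "\<dots> = \<Omega> - ?B"
  proof -
    have dis: "x \<notin> f X'" if "x \<in> X" "x \<notin> f X" "X \<in> P" "X' \<in> P" for x X X'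
    proof (cases "X = X'")
      case False
      then have "X \<inter> X' = {}" using assms(4) that by (simp add: pairwise_def disjnt_def)
      thus ?thesis using f that by blast
    qed (use that in simp)
    have "(\<Union>X\<in>P. X - f X) = \<Union>P - ?B"
    proof (intro equalityI subsetI)
      fix x assume "x \<in> (\<Union>X\<in>P. X - f X)"
      thus "x \<in> \<Union>P - ?B" using dis by auto
    qed auto
    thus ?thesis by (simp only: assms(3))
  qed
  finally have sw: "g ` ?B = \<Omega> - ?B" .
  have "card (\<Omega> - ?B) = card ?B" using sw card_image permutes_inj_on[OF g] by metis
  moreover have "card (\<Omega> - ?B) = n - card ?B"
    using sub by (simp add: card_Diff_subset finite_subset)
  moreover have "card ?B \<le> n" using card_mono[OF _ sub] by simp
  ultimately have "card ?B = 3 * k" using n by linarith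
  hence "?B \<in> half_sets" using sub unfolding half_sets_def by simp
  moreover have "g \<in> partition_stabilizer n ?B" using partition_stabilizer_iff[OF sub] sw g by simp
  ultimately show thesis using that by blast
qed

lemma full_cycle_in_partition_stabilizer:
  assumes "g \<in> full_cycles"
  obtains B where "B \<in> half_sets" "g \<in> partition_stabilizer n B"
proof (rule alternating_partition[of g "{\<Omega>}"])
  show "g permutes \<Omega>" using assms unfolding full_cycles_def by simp
  show "cycles_on g X \<and> even (card X)" if "X \<in> {\<Omega>}" for X
    using assms that n unfolding full_cycles_def by simp
  show thesis if "B \<in> half_sets" "g \<in> partition_stabilizer n B" for B
    using that by (rule \<open>\<And>B. B \<in> half_sets \<Longrightarrow> g \<in> partition_stabilizer n B \<Longrightarrow> thesis\<close>)
qed simp_all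

lemma witnesses_subset_component:
  assumes "A \<in> low_sets"
  shows "witnesses A \<subseteq> component A"
proof
  fix g assume g: "g \<in> witnesses A"
  hence "g permutes \<Omega>" "g ` A = A" using cycles_on_image unfolding witnesses_def by auto
  thus "g \<in> component A" using witnesses_evenperm[OF g assms]
    by (simp add: component_def alt_group_carrier set_stabilizer_iff)
qed

lemma witnesses_component_unique:
  assumes "g \<in> witnesses A" "A \<in> low_sets" "A' \<in> low_sets" "g \<in> component A'"
  shows "A' = A"
proof (cases "A' = {}")
  case True
  hence "evenperm g" using assms(4) by (simp add: component_def alt_group_carrier)
  thus ?thesis using witnesses_evenperm[OF assms(1,2)] True by simp
next
  case False
  hence "g ` A' = A'" using assms(4) by (simp add: component_def set_stabilizer_iff)
  thus ?thesis using witnesses_invariant_low[OF assms(1-3) False] by blast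
qed

lemma full_cycle_not_component:
  assumes "g \<in> full_cycles" "A \<in> low_sets"
  shows "g \<notin> component A"
proof (cases "A = {}")
  case True
  thus ?thesis using full_cycle_odd[OF assms(1)] by (simp add: component_def alt_group_carrier)
next
  case False
  have "A \<subseteq> \<Omega>" "card A < card \<Omega>" using assms(2) k n unfolding low_sets_def by auto
  hence "g ` A \<noteq> A" using full_cycle_invariant[OF assms(1)] False by blast
  thus ?thesis using False by (simp add: component_def set_stabilizer_iff)
qed

end

section \<open>Conjugation and the number of test elements in each member\<close>

context degree_six
begin

lemma permutes_conj: "g permutes \<Omega> \<Longrightarrow> h permutes \<Omega> \<Longrightarrow> h \<circ> g \<circ> inv' h permutes \<Omega>"
  by (intro permutes_compose permutes_inv)

lemma low_set_image:
  assumes "h permutes \<Omega>" "A \<in> low_sets"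
  shows "h ` A \<in> low_sets" "card (h ` A) = card A"
proof -
  show c: "card (h ` A) = card A" using card_image permutes_inj_on[OF assms(1)] by blast
  have "h ` A \<subseteq> \<Omega>" using assms permutes_image[OF assms(1)] unfolding low_sets_def by blast
  thus "h ` A \<in> low_sets" using assms(2) c unfolding low_sets_def by simp
qed

lemma witnesses_conj:
  assumes h: "h permutes \<Omega>" and "A \<in> low_sets" "g \<in> witnesses A"
  shows "h \<circ> g \<circ> inv' h \<in> witnesses (h ` A)"
proof -
  obtain X where X: "X \<subseteq> \<Omega> - A" "card X = long_length (card A)" "cycles_on g X"
      "cycles_on g (\<Omega> - A - X)" and g: "g permutes \<Omega>" "cycles_on g A"
    using assms(3) unfolding witnesses_def by auto
  have bij: "bij h" using h by (rule permutes_bij)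
  note diff = image_set_diff[OF permutes_inj[OF h]]
  have "h ` (\<Omega> - A) = \<Omega> - h ` A" using diff permutes_image[OF h] by simp
  moreover have "h ` (\<Omega> - A - X) = \<Omega> - h ` A - h ` X" using diff permutes_image[OF h] by simp
  moreover have "card (h ` X) = card X" "card (h ` A) = card A"
    using card_image permutes_inj_on[OF h] by blast+
  ultimately have "h ` X \<subseteq> \<Omega> - h ` A \<and> card (h ` X) = long_length (card (h ` A)) \<and>
      cycles_on (h \<circ> g \<circ> inv' h) (h ` X) \<and> cycles_on (h \<circ> g \<circ> inv' h) (\<Omega> - h ` A - h ` X)"
    using X cycles_on_conj[OF bij] by (metis image_mono)
  thus ?thesis
    using permutes_conj[OF g(1) h] cycles_on_conj[OF bij g(2)] unfolding witnesses_def by blast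
qed

lemma finite_witnesses: "finite (witnesses A)"
  by (rule finite_subset[OF _ finite_permutations[of \<Omega>]]) (auto simp: witnesses_def)

lemma card_witnesses_eq:
  assumes "A \<in> low_sets" "A' \<in> low_sets" "card A = card A'"
  shows "card (witnesses A) = card (witnesses A')"
proof -
  have "card (witnesses A) \<le> card (witnesses A')"
    if A: "A \<in> low_sets" "A' \<in> low_sets" "card A = card A'" for A A'
  proof -
    have sub: "A \<subseteq> \<Omega>" "A' \<subseteq> \<Omega>" using A unfolding low_sets_def by auto
    obtain h where h: "h permutes \<Omega>" "h ` A = A'"
      by (rule permutes_image_extend[OF _ sub A(3)]) simp_all
    let ?c = "\<lambda>g. h \<circ> g \<circ> inv' h"
    show ?thesis
    proof (rule card_inj_on_le)
      show "inj_on ?c (witnesses A)"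
        using inj_conj[OF permutes_bij[OF h(1)]] inj_on_subset by blast
      show "?c ` witnesses A \<subseteq> witnesses A'" using witnesses_conj[OF h(1) A(1)] h(2) by blast
    qed (rule finite_witnesses)
  qed
  from this[OF assms] this[OF assms(2,1) assms(3)[symmetric]] show ?thesis by simp
qed

lemma witnesses_nonempty:
  assumes "A \<in> low_sets"
  shows "witnesses A \<noteq> {}"
proof -
  have A: "A \<subseteq> \<Omega>" "card A \<le> 2 * k - 1" "finite A"
    using assms low_set_finite[OF assms] unfolding low_sets_def by simp_all
  have "card (\<Omega> - A) = n - card A" using A by (simp add: card_Diff_subset)
  hence "long_length (card A) \<le> card (\<Omega> - A)" using long_length_arith(3)[OF A(2)] by linarith
  then obtain X where X: "X \<subseteq> \<Omega> - A" "card X = long_length (card A)" "finite X"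
    by (rule obtain_subset_with_card_n)
  define Y where "Y = \<Omega> - A - X"
  have finY: "finite Y" unfolding Y_def by simp
  obtain a where a: "a permutes A" "cycles_on a A" using cycles_on_exists[OF A(3)] by blast
  obtain b where b: "b permutes X" "cycles_on b X" using cycles_on_exists[OF X(3)] by blast
  obtain c where c: "c permutes Y" "cycles_on c Y" using cycles_on_exists[OF finY] by blast
  let ?g = "a \<circ> b \<circ> c"
  have sub: "X \<subseteq> \<Omega>" "Y \<subseteq> \<Omega>" using X Y_def by auto
  have "?g permutes \<Omega>"
    by (intro permutes_compose permutes_subset[OF a(1) A(1)] permutes_subset[OF b(1) sub(1)]
        permutes_subset[OF c(1) sub(2)])
  moreover have "cycles_on ?g A"
  proof -
    have "?g x = a x" if "x \<in> A" for x
    proof -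
      have "x \<notin> X" "x \<notin> Y" using that X Y_def by auto
      thus ?thesis using permutes_not_in[OF b(1)] permutes_not_in[OF c(1)] by simp
    qed
    thus ?thesis using a(2) cycles_on_cong[of A ?g a] by blast
  qed
  moreover have "cycles_on ?g X"
  proof -
    have "?g x = b x" if "x \<in> X" for x
    proof -
      have "x \<notin> Y" "b x \<in> X" using that Y_def permutes_in_image[OF b(1)] by auto
      moreover have "b x \<notin> A" using \<open>b x \<in> X\<close> X by blast
      ultimately show ?thesis using permutes_not_in[OF a(1)] permutes_not_in[OF c(1)] by simp
    qed
    thus ?thesis using b(2) cycles_on_cong[of X ?g b] by blast
  qed
  moreover have "cycles_on ?g Y"
  proof -
    have "?g x = c x" if "x \<in> Y" for x
    proof -
      have "c x \<in> Y" using that permutes_in_image[OF c(1)] by auto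
      hence "c x \<notin> X" "c x \<notin> A" using Y_def by auto
      thus ?thesis using permutes_not_in[OF a(1)] permutes_not_in[OF b(1)] by simp
    qed
    thus ?thesis using c(2) cycles_on_cong[of Y ?g c] by blast
  qed
  ultimately have "?g \<in> witnesses A" unfolding witnesses_def using X Y_def by blast
  thus ?thesis by blast
qed

definition level :: "nat \<Rightarrow> nat set set" where "level i = {A. A \<subseteq> \<Omega> \<and> card A = i}"

lemma finite_level: "finite (level i)" and card_level: "card (level i) = n choose i"
  unfolding level_def using n_subsets[of \<Omega> i] by auto

lemma level_subset_low: "i \<le> 2 * k - 1 \<Longrightarrow> level i \<subseteq> low_sets"
  unfolding level_def low_sets_def by auto

lemma card_UN_witnesses_le:
  assumes "A \<in> low_sets"
  shows "card (\<Union>A'\<in>level (card A). witnesses A') \<le> (n choose card A) * card (witnesses A)"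
proof -
  have "card A \<le> 2 * k - 1" using assms unfolding low_sets_def by simp
  hence low: "level (card A) \<subseteq> low_sets" by (rule level_subset_low)
  have "card (\<Union>A'\<in>level (card A). witnesses A') \<le> (\<Sum>A'\<in>level (card A). card (witnesses A'))"
    by (rule card_UN_le[OF finite_level])
  also have "\<dots> = (\<Sum>A'\<in>level (card A). card (witnesses A))"
    using low card_witnesses_eq[OF _ assms] by (intro sum.cong) (auto simp: level_def)
  also have "\<dots> = (n choose card A) * card (witnesses A)" by (simp add: card_level)
  finally show ?thesis .
qed

text \<open>The class of one witness is spread over the \<open>n choose card A\<close> witness sets
  of its level, all of equal size. One base point per cycle costs \<open>n ^ 3\<close>.\<close>

lemma card_witnesses_ge:
  assumes A: "A \<in> low_sets"
  shows "10 * fact n \<le> 2 ^ n * n ^ 3 * card (witnesses A)"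
proof -
  have cA: "card A \<le> 2 * k - 1" "A \<subseteq> \<Omega>" using A unfolding low_sets_def by auto
  obtain g where g: "g \<in> witnesses A" using witnesses_nonempty[OF A] by blast
  obtain X Y where XY: "cycles_on g A" "cycles_on g X" "cycles_on g Y" "A \<union> X \<union> Y = \<Omega>"
    using witnessesE[OF g A] by metis
  \<comment> \<open>The default 1 keeps the base point inside \<Omega> when A is empty.\<close>
  define r where "r Z = (if Z = {} then 1 else (SOME x. x \<in> Z))" for Z :: "nat set"
  have r: "r Z \<in> Z" if "Z \<noteq> {}" for Z
    using that some_in_eq[of Z] unfolding r_def by simp
  have rO: "r Z \<in> \<Omega>" if "Z \<subseteq> \<Omega>" for Z
    using r[of Z] that k n by (cases "Z = {}") (auto simp: r_def)
  let ?R = "{r A, r X, r Y}"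
  have R: "?R \<subseteq> \<Omega>" using rO[of A] rO[of X] rO[of Y] XY(4) by auto
  have reach: "\<exists>s\<in>?R. \<exists>m. (g ^^ m) s = x" if "x \<in> \<Omega>" for x
  proof -
    have *: "\<exists>m. (g ^^ m) (r Z) = x" if "cycles_on g Z" "x \<in> Z" for Z
      using cycles_onD[OF that(1) _ that(2)] r that(2) by blast
    show ?thesis using *[OF XY(1)] *[OF XY(2)] *[OF XY(3)] XY(4) \<open>x \<in> \<Omega>\<close> by blast
  qed
  let ?c = "(\<lambda>h. h \<circ> g \<circ> inv' h) ` {h. h permutes \<Omega>}"
  let ?U = "\<Union>A'\<in>level (card A). witnesses A'"
  have "?c \<subseteq> ?U"
  proof clarify
    fix h assume h: "h permutes \<Omega>"
    have "h ` A \<in> level (card A)"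
      using low_set_image[OF h A] unfolding level_def low_sets_def by simp
    thus "h \<circ> g \<circ> inv' h \<in> ?U" using witnesses_conj[OF h A g] by blast
  qed
  hence "card ?c \<le> card ?U" using finite_level finite_witnesses by (intro card_mono) auto
  hence c: "card ?c \<le> (n choose card A) * card (witnesses A)" using card_UN_witnesses_le[OF A] by linarith
  have "n ^ card ?R \<le> n ^ 3"
  proof (rule power_increasing)
    have "card ?R \<le> length [r A, r X, r Y]" using card_length[of "[r A, r X, r Y]"] by simp
    thus "card ?R \<le> 3" by simp
  qed (use k n in simp)
  hence "n ^ card ?R * card ?c \<le> n ^ 3 * ((n choose card A) * card (witnesses A))"
    using c by (rule mult_le_mono)
  hence "fact n \<le> n ^ 3 * ((n choose card A) * card (witnesses A))"
    using card_conjugates_ge[OF _ R reach] by simp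
  hence "10 * fact n \<le> 10 * (n ^ 3 * ((n choose card A) * card (witnesses A)))" by simp
  also have "\<dots> = (10 * (n choose card A)) * (n ^ 3 * card (witnesses A))" by simp
  also have "\<dots> \<le> 2 ^ n * (n ^ 3 * card (witnesses A))"
    using cA k n by (intro mult_le_mono1 ten_binomial_le) auto
  finally show ?thesis by (simp add: mult.assoc)
qed

definition swapping_cycles :: "nat set \<Rightarrow> (nat \<Rightarrow> nat) set" where
  "swapping_cycles B = full_cycles \<inter> partition_stabilizer n B"

lemma finite_swapping_cycles: "finite (swapping_cycles B)"
  by (rule finite_subset[OF _ finite_permutations[of \<Omega>]])
    (auto simp: swapping_cycles_def full_cycles_def)

lemma full_cycles_conj:
  assumes "h permutes \<Omega>" "g \<in> full_cycles"
  shows "h \<circ> g \<circ> inv' h \<in> full_cycles"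
  using assms cycles_on_conj[OF permutes_bij[OF assms(1)], of g \<Omega>] permutes_conj permutes_image[OF assms(1)]
  unfolding full_cycles_def by simp

lemma swapping_cycles_conj:
  assumes h: "h permutes \<Omega>" and B: "B \<subseteq> \<Omega>" and g: "g \<in> swapping_cycles B"
  shows "h \<circ> g \<circ> inv' h \<in> swapping_cycles (h ` B)"
proof -
  have hB: "h ` B \<subseteq> \<Omega>" using B permutes_image[OF h] by blast
  have hd: "h ` (\<Omega> - B) = \<Omega> - h ` B"
    using image_set_diff[OF permutes_inj[OF h]] permutes_image[OF h] by simp
  have g': "g permutes \<Omega>" "g ` B = B \<or> g ` B = \<Omega> - B" "g \<in> full_cycles"
    using g partition_stabilizer_iff[OF B] unfolding swapping_cycles_def by auto
  have "(h \<circ> g \<circ> inv' h) ` (h ` B) = h ` B \<or> (h \<circ> g \<circ> inv' h) ` (h ` B) = \<Omega> - h ` B"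
    unfolding image_conj[OF permutes_bij[OF h]] using g'(2) hd by metis
  thus ?thesis
    using full_cycles_conj[OF h g'(3)] permutes_conj[OF g'(1) h]
    unfolding swapping_cycles_def by (simp only: Int_iff partition_stabilizer_iff[OF hB] simp_thms)
qed

lemma card_swapping_cycles_le:
  assumes "B \<in> half_sets" "B' \<in> half_sets"
  shows "card (swapping_cycles B) \<le> card (swapping_cycles B')"
proof -
  have sub: "B \<subseteq> \<Omega>" "B' \<subseteq> \<Omega>" "card B = card B'" using assms unfolding half_sets_def by auto
  obtain h where h: "h permutes \<Omega>" "h ` B = B'"
    by (rule permutes_image_extend[OF _ sub]) simp_all
  let ?c = "\<lambda>g. h \<circ> g \<circ> inv' h"
  show ?thesis
  proof (rule card_inj_on_le)
    show "inj_on ?c (swapping_cycles B)"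
      using inj_conj[OF permutes_bij[OF h(1)]] inj_on_subset by blast
    show "?c ` swapping_cycles B \<subseteq> swapping_cycles B'"
      using swapping_cycles_conj[OF h(1) sub(1)] h(2) by blast
  qed (rule finite_swapping_cycles)
qed

lemma half_sets_level: "half_sets = level (3 * k)"
  unfolding half_sets_def level_def ..

text \<open>One cycle needs one base point and costs only n. The spare factor \<open>n ^ 2\<close>
  exceeds 10, so bounding the number of half sets by \<open>2 ^ n\<close> still reaches the common
  threshold.\<close>

lemma card_swapping_cycles_ge:
  assumes B: "B \<in> half_sets"
  shows "10 * fact n \<le> 2 ^ n * n ^ 3 * card (swapping_cycles B)"
proof -
  obtain g where g: "g permutes \<Omega>" "cycles_on g \<Omega>" by (rule cycles_on_exists[of \<Omega>]) simp_all
  hence gF: "g \<in> full_cycles" unfolding full_cycles_def by simp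
  have one: "1 \<in> \<Omega>" using k n by simp
  let ?c = "(\<lambda>h. h \<circ> g \<circ> inv' h) ` {h. h permutes \<Omega>}"
  have "fact n \<le> n ^ card {1 :: nat} * card ?c"
    using card_conjugates_ge[of \<Omega> "{1}" g] one cycles_onD[OF g(2) one] by simp
  hence 1: "fact n \<le> n * card ?c" by simp
  have "?c \<subseteq> (\<Union>B'\<in>half_sets. swapping_cycles B')"
  proof clarify
    fix h assume "h permutes \<Omega>"
    hence "h \<circ> g \<circ> inv' h \<in> full_cycles" using gF by (rule full_cycles_conj)
    thus "h \<circ> g \<circ> inv' h \<in> (\<Union>B'\<in>half_sets. swapping_cycles B')"
      using full_cycle_in_partition_stabilizer unfolding swapping_cycles_def by blast
  qed
  hence "card ?c \<le> card (\<Union>B'\<in>half_sets. swapping_cycles B')"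
    using finite_level finite_swapping_cycles unfolding half_sets_level by (intro card_mono) auto
  also have "\<dots> \<le> (\<Sum>B'\<in>half_sets. card (swapping_cycles B'))"
    unfolding half_sets_level by (rule card_UN_le[OF finite_level])
  also have "\<dots> \<le> (\<Sum>B'\<in>half_sets. card (swapping_cycles B))"
    using card_swapping_cycles_le[OF _ B] by (rule sum_mono)
  also have "\<dots> = (n choose (3 * k)) * card (swapping_cycles B)"
    unfolding half_sets_level by (simp add: card_level)
  also have "\<dots> \<le> 2 ^ n * card (swapping_cycles B)"
    by (intro mult_le_mono1 binomial_le_pow2)
  finally have 2: "card ?c \<le> 2 ^ n * card (swapping_cycles B)" .
  have "10 * n \<le> n * n ^ 2"
  proof -
    have "36 \<le> n" using k n by simp
    hence "36 * 36 \<le> n * n" by (intro mult_le_mono)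
    hence "n * 10 \<le> n * (n * n)" by (intro mult_le_mono2) linarith
    thus ?thesis by (simp add: power2_eq_square mult.commute)
  qed
  hence 3: "10 * n \<le> n ^ 3" by (simp add: power3_eq_cube power2_eq_square)
  have "10 * fact n \<le> (10 * n) * card ?c" using 1 by simp
  also have "\<dots> \<le> n ^ 3 * (2 ^ n * card (swapping_cycles B))" using 3 2 by (rule mult_le_mono)
  finally show ?thesis by (simp add: ac_simps)
qed
end

section \<open>The test set and the size of the collection\<close>

context degree_six
begin

definition test_set :: "(nat \<Rightarrow> nat) set" where
  "test_set = full_cycles \<union> (\<Union>A\<in>low_sets. witnesses A)"

lemma finite_low_sets: "finite low_sets"
  unfolding low_sets_def by simp

lemma finite_half_sets: "finite half_sets"
  unfolding half_sets_def by simp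

lemma test_set_permutes: "g \<in> test_set \<Longrightarrow> g permutes \<Omega>"
  unfolding test_set_def full_cycles_def witnesses_def by auto

lemma finite_test_set: "finite test_set"
  by (rule finite_subset[OF _ finite_permutations[of \<Omega>]]) (auto dest: test_set_permutes)

lemma component_Int_test_set:
  assumes "A \<in> low_sets"
  shows "component A \<inter> test_set = witnesses A"
proof
  show "component A \<inter> test_set \<subseteq> witnesses A"
  proof
    fix g assume g: "g \<in> component A \<inter> test_set"
    hence "g \<notin> full_cycles" using full_cycle_not_component[OF _ assms] by blast
    then obtain A' where A': "A' \<in> low_sets" "g \<in> witnesses A'" using g unfolding test_set_def by blast
    hence "A = A'" using witnesses_component_unique[OF A'(2,1) assms] g by blast
    thus "g \<in> witnesses A" using A' by simp
  qed
  show "witnesses A \<subseteq> component A \<inter> test_set"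
    using witnesses_subset_component[OF assms] assms unfolding test_set_def by blast
qed

lemma partition_stabilizer_Int_test_set:
  assumes "B \<in> half_sets"
  shows "partition_stabilizer n B \<inter> test_set = swapping_cycles B"
  using witnesses_not_partition_stabilizer[OF _ _ assms]
  unfolding test_set_def swapping_cycles_def by blast

lemma swapping_cycles_nonempty:
  assumes "B \<in> half_sets"
  shows "swapping_cycles B \<noteq> {}"
proof
  assume "swapping_cycles B = {}"
  hence "10 * fact n \<le> (0 :: nat)" using card_swapping_cycles_ge[OF assms] by simp
  thus False by simp
qed

lemma full_cycles_nonempty: "full_cycles \<noteq> {}"
proof -
  obtain g where "g permutes \<Omega>" "cycles_on g \<Omega>" by (rule cycles_on_exists[of \<Omega>]) simp_all
  thus ?thesis unfolding full_cycles_def by blast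
qed

lemma empty_low: "{} \<in> low_sets" unfolding low_sets_def by simp

lemma optimal_cover_eq:
  "optimal_cover n = partition_stabilizer n ` half_sets \<union> component ` low_sets"
proof -
  have d: "n div 2 = 3 * k" "n div 3 = 2 * k" using n by simp_all
  have "component ` low_sets = {carrier (alt_group n)} \<union>
      {set_stabilizer n A | A. A \<subseteq> \<Omega> \<and> 1 \<le> card A \<and> card A \<le> 2 * k - 1}" (is "_ = ?R")
  proof (intro equalityI subsetI)
    fix H assume "H \<in> component ` low_sets"
    then obtain A where A: "A \<in> low_sets" "H = component A" by blast
    show "H \<in> ?R"
    proof (cases "A = {}")
      case True
      then show ?thesis using A by (simp add: component_def)
    next
      case False
      then have "1 \<le> card A" using low_set_finite[OF A(1)] by (simp add: Suc_le_eq card_gt_0_iff)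
      then show ?thesis using A False unfolding low_sets_def component_def by auto
    qed
  next
    fix H assume "H \<in> ?R"
    then consider "H = carrier (alt_group n)"
      | A where "H = set_stabilizer n A" "A \<subseteq> \<Omega>" "1 \<le> card A" "card A \<le> 2 * k - 1" by blast
    then show "H \<in> component ` low_sets"
    proof cases
      case 1
      then have "H = component {}" by (simp add: component_def)
      then show ?thesis using empty_low by blast
    next
      case 2
      then have "A \<in> low_sets" "A \<noteq> {}" unfolding low_sets_def by auto
      then show ?thesis using 2(1) by (intro image_eqI[of _ _ A]) (auto simp: component_def)
    qed
  qed
  moreover have "{partition_stabilizer n B | B. B \<subseteq> \<Omega> \<and> card B = 3 * k} = partition_stabilizer n ` half_sets"
    unfolding half_sets_def by blast
  ultimately show ?thesis unfolding optimal_cover_def d Un_assoc by (simp only:)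
qed

lemma optimal_cover_unique:
  assumes "H \<in> optimal_cover n" "H' \<in> optimal_cover n" "g \<in> test_set" "g \<in> H" "g \<in> H'"
  shows "H = H'"
proof (cases "g \<in> full_cycles")
  case True
  then obtain B B' where B: "B \<in> half_sets" "H = partition_stabilizer n B"
      "B' \<in> half_sets" "H' = partition_stabilizer n B'"
    using assms full_cycle_not_component[OF True] unfolding optimal_cover_eq by blast
  have "B' = B \<or> B' = \<Omega> - B" using full_cycle_partition_unique[OF True B(1,3)] assms B by simp
  moreover have "B \<subseteq> \<Omega>" using B(1) unfolding half_sets_def by simp
  ultimately show ?thesis using B partition_stabilizer_complement by blast
next
  case False
  then obtain A where A: "A \<in> low_sets" "g \<in> witnesses A" using assms(3) unfolding test_set_def by blast
  have "K = component A" if "K \<in> optimal_cover n" "g \<in> K" for K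
    using that witnesses_not_partition_stabilizer[OF A(2,1)] witnesses_component_unique[OF A(2,1)]
    unfolding optimal_cover_eq by blast
  thus ?thesis using assms by blast
qed

lemma optimal_cover_Int_nonempty:
  assumes "H \<in> optimal_cover n"
  shows "H \<inter> test_set \<noteq> {}"
  using assms unfolding optimal_cover_eq
  by (elim UnE imageE) (simp_all add: component_Int_test_set witnesses_nonempty
      partition_stabilizer_Int_test_set swapping_cycles_nonempty)

lemma optimal_cover_Int_large:
  assumes "H \<in> optimal_cover n"
  shows "10 * fact n \<le> 2 ^ n * n ^ 3 * card (H \<inter> test_set)"
  using assms unfolding optimal_cover_eq
  by (elim UnE imageE) (simp_all only: component_Int_test_set card_witnesses_ge
      partition_stabilizer_Int_test_set card_swapping_cycles_ge)

lemma finite_optimal_cover: "finite (optimal_cover n)"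
  unfolding optimal_cover_eq using finite_low_sets finite_half_sets by simp

lemma inj_on_component: "inj_on component low_sets"
proof (rule inj_onI)
  fix A A' assume A: "A \<in> low_sets" "A' \<in> low_sets" "component A = component A'"
  obtain g where "g \<in> witnesses A" using witnesses_nonempty[OF A(1)] by blast
  thus "A = A'"
    using witnesses_subset_component[OF A(1)] witnesses_component_unique[OF _ A(1,2)] A(3) by blast
qed

lemma partition_stabilizer_not_component:
  "partition_stabilizer n ` half_sets \<inter> component ` low_sets = {}"
proof -
  have "partition_stabilizer n B \<noteq> component A" if "A \<in> low_sets" "B \<in> half_sets" for A B
    using that witnesses_nonempty[of A] witnesses_subset_component[of A]
      witnesses_not_partition_stabilizer[of _ A B] by blast
  thus ?thesis by blast
qed

lemma low_sets_levels: "low_sets = (\<Union>i\<in>{..2 * k - 1}. level i)"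
  unfolding low_sets_def level_def by auto

lemma level_disjoint: "i \<noteq> j \<Longrightarrow> level i \<inter> level j = {}"
  unfolding level_def by auto

lemma card_optimal_cover:
  "real (card (optimal_cover n)) =
     (1/2) * real (n choose (n div 2)) + (\<Sum>i = 0..n div 3 - 1. real (n choose i))"
proof -
  \<comment> \<open>A half and its complement have the same stabilizer; choosing the half that
    contains 1 accounts for the factor 1/2.\<close>
  let ?L = "{B \<in> half_sets. 1 \<in> B}" and ?L' = "{B \<in> half_sets. 1 \<notin> B}"
  have one: "1 \<in> \<Omega>" using k n by simp
  have comp: "\<Omega> - B \<in> half_sets" if "B \<in> half_sets" for B
    using that n unfolding half_sets_def by (auto simp: card_Diff_subset finite_subset)
  have dd: "\<Omega> - (\<Omega> - B) = B" if "B \<in> half_sets" for B using that unfolding half_sets_def by auto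
  have "bij_betw ((-) \<Omega>) ?L ?L'"
  proof (rule bij_betwI[where g = "(-) \<Omega>"])
    show "(-) \<Omega> \<in> ?L \<rightarrow> ?L'" using comp by auto
    show "(-) \<Omega> \<in> ?L' \<rightarrow> ?L" using comp one by auto
  qed (use dd in auto)
  hence "card ?L = card ?L'" by (rule bij_betw_same_card)
  moreover have "card half_sets = card ?L + card ?L'"
  proof -
    have "half_sets = ?L \<union> ?L'" "?L \<inter> ?L' = {}" by auto
    thus ?thesis using finite_half_sets card_Un_disjoint[of ?L ?L'] by simp
  qed
  ultimately have cL: "2 * card ?L = n choose (3 * k)"
    using card_level[of "3 * k"] half_sets_level by simp
  have "partition_stabilizer n ` half_sets = partition_stabilizer n ` ?L"
  proof (intro equalityI subsetI)
    fix H assume "H \<in> partition_stabilizer n ` half_sets"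
    then obtain B where B: "B \<in> half_sets" "H = partition_stabilizer n B" by blast
    show "H \<in> partition_stabilizer n ` ?L"
    proof (cases "1 \<in> B")
      case False
      then have "\<Omega> - B \<in> ?L" using comp[OF B(1)] one by simp
      moreover have "H = partition_stabilizer n (\<Omega> - B)"
        using B partition_stabilizer_complement unfolding half_sets_def by simp
      ultimately show ?thesis by blast
    qed (use B in blast)
  qed auto
  moreover have "inj_on (partition_stabilizer n) ?L"
  proof (rule inj_onI)
    fix B B' assume B: "B \<in> ?L" "B' \<in> ?L" "partition_stabilizer n B = partition_stabilizer n B'"
    obtain g where "g \<in> swapping_cycles B" using swapping_cycles_nonempty B(1) by blast
    hence "B' = B \<or> B' = \<Omega> - B"
      using full_cycle_partition_unique[of g B B'] B unfolding swapping_cycles_def by simp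
    thus "B = B'" using B by auto
  qed
  ultimately have 1: "card (partition_stabilizer n ` half_sets) = card ?L" by (simp add: card_image)
  have 2: "card (component ` low_sets) = (\<Sum>i\<in>{..2 * k - 1}. n choose i)"
  proof -
    have "card (component ` low_sets) = card low_sets" using inj_on_component by (rule card_image)
    also have "\<dots> = (\<Sum>i\<in>{..2 * k - 1}. card (level i))"
      unfolding low_sets_levels using finite_level level_disjoint
      by (intro card_UN_disjoint) auto
    finally show ?thesis by (simp add: card_level)
  qed
  have "card (optimal_cover n) = card ?L + (\<Sum>i\<in>{..2 * k - 1}. n choose i)"
    unfolding optimal_cover_eq
    using card_Un_disjoint[OF _ _ partition_stabilizer_not_component] 1 2 finite_half_sets finite_low_sets
    by simp
  moreover have "n div 2 = 3 * k" "n div 3 = 2 * k" using n by simp_all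
  moreover have "real (card ?L) = (1/2) * real (n choose (3 * k))" using cL by linarith
  ultimately show ?thesis by (simp add: atLeast0AtMost)
qed

section \<open>Stabilizers of sets with at least n / 3 and fewer than n / 2 points\<close>

text \<open>Only X, Y, A \<union> X and A \<union> Y can have j points. X and A \<union> Y are
  complementary, as are Y and A \<union> X, so each pair supplies at most one set of size j < 3 * k.
  If A has 2 * k - 1 points, its unions with X or Y are too large and X, Y differ in size; if j = 2
  * k and A is smaller, all four candidates are too large.\<close>

lemma card_invariant_sets_le:
  assumes g: "g \<in> witnesses A" and A: "A \<in> low_sets" and j: "2 * k \<le> j" "j < 3 * k"
  shows "card {J \<in> level j. g ` J = J} \<le>
    (if card A = 2 * k - 1 then 1 else if j = 2 * k then 0 else 2)"
proof (rule witnesses_long_cycles[OF g A])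
  fix X Y
  assume h: "cycles_on g A" "cycles_on g X" "cycles_on g Y"
    and U: "A \<union> X \<union> Y = \<Omega>" and disj: "A \<inter> X = {}" "A \<inter> Y = {}" "X \<inter> Y = {}"
    and fin: "finite A" "finite X" "finite Y"
    and c: "card A \<le> 2 * k - 1" "card A + card X + card Y = n"
    "2 * k + 1 \<le> card X" "2 * k \<le> card Y"
    and c1: "card A < 2 * k - 1 \<longrightarrow> 2 * k + 1 \<le> card Y"
    and c2: "card A = 2 * k - 1 \<longrightarrow> card X = 2 * k + 1 \<and> card Y = 2 * k"
  let ?S = "{J \<in> level j. g ` J = J}"
  have cu: "card (A \<union> X) = card A + card X" "card (A \<union> Y) = card A + card Y"
    "card (X \<union> Y) = card X + card Y" "card (A \<union> X \<union> Y) = 6 * k"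
    using disj fin U n by (simp_all add: card_Un_disjoint)
  have J: "J \<in> {X, Y, A \<union> X, A \<union> Y} \<and> card J = j" if "J \<in> ?S" for J
  proof -
    have "J \<subseteq> \<Omega>" "card J = j" "g ` J = J" using that unfolding level_def by auto
    moreover from this have "J \<in> {{}, A, X, Y, A \<union> X, A \<union> Y, X \<union> Y, A \<union> X \<union> Y}"
      using invariant_union[OF h] U by simp
    moreover have "card J \<noteq> card ({} :: nat set)" "card J \<noteq> card A" "card J \<noteq> card (X \<union> Y)"
        "card J \<noteq> card (A \<union> X \<union> Y)"
      unfolding cu \<open>card J = j\<close> card.empty using c j k by linarith+
    ultimately show ?thesis by blast
  qed
  show ?thesis
  proof (cases "card A = 2 * k - 1")
    case True
    have "?S \<subseteq> {if j = 2 * k then Y else X}"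
    proof
      fix K assume "K \<in> ?S"
      from J[OF this] show "K \<in> {if j = 2 * k then Y else X}" using True c2 cu j k by auto
    qed
    hence "card ?S \<le> 1" using card_mono[of "{if j = 2 * k then Y else X}" ?S] by simp
    thus ?thesis using True by simp
  next
    case False
    show ?thesis
    proof (cases "j = 2 * k")
      case True
      have "?S = {}"
      proof (rule ccontr)
        assume "?S \<noteq> {}"
        then obtain K where "K \<in> ?S" by blast
        from J[OF this] show False using True False c c1 cu by auto
      qed
      hence "card ?S = 0" by (simp only: card.empty)
      thus ?thesis using True False by simp
    next
      case j2: False
      let ?T = "{if card X = j then X else A \<union> Y, if card Y = j then Y else A \<union> X}"
      have "card X = j \<Longrightarrow> card (A \<union> Y) \<noteq> j" "card Y = j \<Longrightarrow> card (A \<union> X) \<noteq> j"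
        unfolding cu using c(2) j n by linarith+
      hence "?S \<subseteq> ?T" using J by auto
      hence "card ?S \<le> card ?T" by (rule card_mono[rotated]) simp
      also have "\<dots> \<le> 2" by (simp add: card_insert_if)
      finally show ?thesis using False j2 by simp
    qed
  qed
qed

lemma card_stabilizer_Int_le:
  assumes i: "i \<le> 2 * k - 1" and J: "J \<in> level j" "J' \<in> level j"
  shows "card {g \<in> (\<Union>A\<in>level i. witnesses A). g ` J = J}
    \<le> card {g \<in> (\<Union>A\<in>level i. witnesses A). g ` J' = J'}" (is "card ?S \<le> card ?S'")
proof -
  have sub: "J \<subseteq> \<Omega>" "J' \<subseteq> \<Omega>" "card J = card J'" using J unfolding level_def by auto
  obtain h where h: "h permutes \<Omega>" "h ` J = J'"
    by (rule permutes_image_extend[OF _ sub]) simp_all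
  let ?c = "\<lambda>g. h \<circ> g \<circ> inv' h"
  show ?thesis
  proof (rule card_inj_on_le)
    show "inj_on ?c ?S" using inj_conj[OF permutes_bij[OF h(1)]] inj_on_subset by blast
    show "?c ` ?S \<subseteq> ?S'"
    proof clarify
      fix g A assume gA: "g ` J = J" "A \<in> level i" "g \<in> witnesses A"
      have A: "A \<in> low_sets" using gA(2) level_subset_low[OF i] by blast
      have "h ` A \<in> level i"
        using low_set_image[OF h(1) A] gA(2) unfolding level_def low_sets_def by simp
      moreover have "?c g \<in> witnesses (h ` A)" by (rule witnesses_conj[OF h(1) A gA(3)])
      moreover have "?c g ` J' = J'"
        using image_conj[OF permutes_bij[OF h(1)], of g J] gA(1) h(2) by simp
      ultimately show "?c g \<in> (\<Union>A\<in>level i. witnesses A) \<and> ?c g ` J' = J'" by blast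
    qed
    show "finite ?S'" using finite_level finite_witnesses by simp
  qed
qed

text \<open>Pairs of a witness of level i and a j-set fixed by it are counted twice: by conjugation
  every j-set occurs equally often, and every witness occurs at most f times.\<close>

lemma binomial_mult_stabilizer_le:
  assumes i: "i \<le> 2 * k - 1" and J: "J \<in> level j" and A: "A \<in> level i"
    and f: "\<And>A g. A \<in> level i \<Longrightarrow> g \<in> witnesses A \<Longrightarrow> card {J \<in> level j. g ` J = J} \<le> f"
  shows "(n choose j) * card {g \<in> (\<Union>A\<in>level i. witnesses A). g ` J = J}
    \<le> f * ((n choose i) * card (witnesses A))"
proof -
  let ?U = "\<Union>A\<in>level i. witnesses A"
  have finU: "finite ?U" using finite_level finite_witnesses by simp
  have "(n choose j) * card {g \<in> ?U. g ` J = J} = (\<Sum>J'\<in>level j. card {g \<in> ?U. g ` J = J})"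
    by (simp add: card_level)
  also have "\<dots> \<le> (\<Sum>J'\<in>level j. card {g \<in> ?U. g ` J' = J'})"
    using card_stabilizer_Int_le[OF i J] by (rule sum_mono)
  also have "\<dots> = (\<Sum>g\<in>?U. card {J' \<in> level j. g ` J' = J'})"
    by (rule sum_multicount_gen[OF finite_level finU]) simp
  also have "\<dots> \<le> (\<Sum>g\<in>?U. f)" using f by (intro sum_mono) blast
  also have "\<dots> = f * card ?U" by simp
  also have "\<dots> \<le> f * ((n choose i) * card (witnesses A))"
  proof -
    have "card A = i" "A \<in> low_sets" using A level_subset_low[OF i] unfolding level_def by auto
    thus ?thesis using card_UN_witnesses_le[of A] by (intro mult_le_mono2) simp
  qed
  finally show ?thesis .
qed

lemma level_nonempty: "i \<le> n \<Longrightarrow> level i \<noteq> {}"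
  using card_level[of i] by (metis binomial_eq_0_iff card.empty not_less)

lemma card_witnesses_pos: "A \<in> low_sets \<Longrightarrow> 0 < card (witnesses A)"
  using witnesses_nonempty finite_witnesses by (simp add: card_gt_0_iff)

lemma level_weight_le:
  assumes i: "i \<le> 2 * k - 1" and J: "J \<in> level j" "j \<le> n"
    and f: "\<And>A g. A \<in> level i \<Longrightarrow> g \<in> witnesses A \<Longrightarrow> card {J \<in> level j. g ` J = J} \<le> f"
  shows "(\<Sum>A\<in>level i. real (card (set_stabilizer n J \<inter> witnesses A)) / real (card (witnesses A)))
    \<le> real (f * (n choose i)) / real (n choose j)"
proof -
  have "i \<le> n" using i n by simp
  then obtain A0 where A0: "A0 \<in> level i" using level_nonempty by blast
  have low: "level i \<subseteq> low_sets" by (rule level_subset_low[OF i])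
  let ?U = "\<Union>A\<in>level i. witnesses A"
  let ?N = "card (witnesses A0)"
  have N: "0 < ?N" using A0 low card_witnesses_pos by blast
  have C: "0 < n choose j" using J(2) by simp
  have disj: "witnesses A \<inter> witnesses A' = {}" if "A \<in> level i" "A' \<in> level i" "A \<noteq> A'" for A A'
    using that low witnesses_component_unique[of _ A A'] witnesses_subset_component[of A'] by blast
  have "(\<Sum>A\<in>level i. real (card (set_stabilizer n J \<inter> witnesses A)) / real (card (witnesses A)))
      = (\<Sum>A\<in>level i. real (card (set_stabilizer n J \<inter> witnesses A)) / real ?N)"
  proof (rule sum.cong[OF refl])
    fix A assume "A \<in> level i"
    hence "card (witnesses A) = ?N"
      using A0 low by (intro card_witnesses_eq) (auto simp: level_def)
    thus "real (card (set_stabilizer n J \<inter> witnesses A)) / real (card (witnesses A))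
        = real (card (set_stabilizer n J \<inter> witnesses A)) / real ?N" by simp
  qed
  also have "\<dots> = real (\<Sum>A\<in>level i. card (set_stabilizer n J \<inter> witnesses A)) / real ?N"
    by (simp add: sum_divide_distrib)
  also have "(\<Sum>A\<in>level i. card (set_stabilizer n J \<inter> witnesses A))
      = card (\<Union>A\<in>level i. set_stabilizer n J \<inter> witnesses A)"
  proof (rule card_UN_disjoint[symmetric, OF finite_level])
    show "\<forall>A\<in>level i. finite (set_stabilizer n J \<inter> witnesses A)" using finite_witnesses by simp
    show "\<forall>A\<in>level i. \<forall>A'\<in>level i. A \<noteq> A' \<longrightarrow>
        (set_stabilizer n J \<inter> witnesses A) \<inter> (set_stabilizer n J \<inter> witnesses A') = {}"
      using disj by blast
  qed
  also have "(\<Union>A\<in>level i. set_stabilizer n J \<inter> witnesses A) = {g \<in> ?U. g ` J = J}"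
  proof -
    have "g permutes \<Omega>" if "g \<in> witnesses A" for g A using that unfolding witnesses_def by blast
    thus ?thesis unfolding set_stabilizer_def sym_group_carrier by blast
  qed
  also have "real (card {g \<in> ?U. g ` J = J}) / real ?N \<le> real (f * (n choose i)) / real (n choose j)"
  proof -
    have "(n choose j) * card {g \<in> ?U. g ` J = J} \<le> f * ((n choose i) * ?N)"
      by (rule binomial_mult_stabilizer_le[OF i J(1) A0 f])
    hence "real (n choose j) * real (card {g \<in> ?U. g ` J = J}) \<le> real (f * (n choose i)) * real ?N"
      unfolding of_nat_mult[symmetric] of_nat_le_iff by (simp add: mult.assoc)
    thus ?thesis using N C by (simp add: field_simps)
  qed
  finally show ?thesis .
qed

text \<open>No n-cycle fixes J, so only the components contribute. For j = 2 * k just the level 2 *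
  k - 1 remains, with share at most 1/2 by the doubling of binomial coefficients; for larger j the
  weighted sum of binomial coefficients applies.\<close>

lemma cover_weight_set_stabilizer:
  assumes J: "J \<in> level j" and j: "2 * k \<le> j" "j < 3 * k"
  shows "cover_weight (optimal_cover n) test_set (set_stabilizer n J) < 1"
proof -
  let ?M = "set_stabilizer n J"
  let ?w = "\<lambda>H. real (card (?M \<inter> (H \<inter> test_set))) / real (card (H \<inter> test_set))"
  let ?v = "\<lambda>A. real (card (?M \<inter> witnesses A)) / real (card (witnesses A))"
  let ?f = "\<lambda>i. if i = 2 * k - 1 then 1 else if j = 2 * k then 0 else 2 :: nat"
  have jn: "j \<le> n" using j n by simp
  have JO: "J \<subseteq> \<Omega>" "card J = j" using J unfolding level_def by auto
  have "?w H = 0" if "H \<in> partition_stabilizer n ` half_sets" for H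
  proof -
    obtain B where B: "B \<in> half_sets" "H = partition_stabilizer n B" using \<open>H \<in> _\<close> by blast
    have "J \<noteq> {}" "J \<noteq> \<Omega>" using JO j k n by auto
    hence "?M \<inter> swapping_cycles B = {}"
      using full_cycle_invariant[OF _ _ JO(1)] unfolding swapping_cycles_def
      by (auto simp: set_stabilizer_iff)
    thus ?thesis using B partition_stabilizer_Int_test_set by simp
  qed
  hence "(\<Sum>H\<in>partition_stabilizer n ` half_sets. ?w H) = 0" by (intro sum.neutral) blast
  hence "cover_weight (optimal_cover n) test_set ?M = (\<Sum>H\<in>component ` low_sets. ?w H)"
    unfolding cover_weight_def optimal_cover_eq
    using sum.union_disjoint[OF _ _ partition_stabilizer_not_component, of ?w] finite_half_sets
      finite_low_sets by simp
  also have "\<dots> = (\<Sum>A\<in>low_sets. ?v A)"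
    using component_Int_test_set by (subst sum.reindex[OF inj_on_component]) simp
  also have "\<dots> = (\<Sum>i\<in>{..2 * k - 1}. \<Sum>A\<in>level i. ?v A)"
    unfolding low_sets_levels using finite_level level_disjoint
    by (intro sum.UNION_disjoint) auto
  also have "\<dots> \<le> (\<Sum>i\<in>{..2 * k - 1}. real (?f i * (n choose i)) / real (n choose j))"
  proof (rule sum_mono)
    fix i assume "i \<in> {..2 * k - 1}"
    hence i: "i \<le> 2 * k - 1" by simp
    show "(\<Sum>A\<in>level i. ?v A) \<le> real (?f i * (n choose i)) / real (n choose j)"
    proof (rule level_weight_le[OF i J jn])
      fix A g assume A: "A \<in> level i" "g \<in> witnesses A"
      hence "A \<in> low_sets" "card A = i" using level_subset_low[OF i] unfolding level_def by auto
      thus "card {J \<in> level j. g ` J = J} \<le> ?f i" using card_invariant_sets_le[OF A(2) _ j] by simp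
    qed
  qed
  also have "\<dots> = real (\<Sum>i\<in>{..2 * k - 1}. ?f i * (n choose i)) / real (n choose j)"
    by (simp only: sum_divide_distrib of_nat_sum)
  also have "\<dots> < 1"
  proof -
    have s: "{..2 * k - 1} = insert (2 * k - 1) {..<2 * k - 1}" by auto
    have "(\<Sum>i\<in>{..2 * k - 1}. ?f i * (n choose i))
        = (n choose (2 * k - 1)) + (\<Sum>i<2 * k - 1. (if j = 2 * k then 0 else 2) * (n choose i))"
      unfolding s by (subst sum.insert) auto
    also have "\<dots> < n choose j"
    proof (cases "j = 2 * k")
      case True
      have "2 * (n choose (2 * k - 1)) \<le> n choose Suc (2 * k - 1)"
        using k n by (intro binomial_double_le) auto
      moreover have "0 < n choose (2 * k - 1)" using n by simp
      ultimately have "n choose (2 * k - 1) < n choose Suc (2 * k - 1)" by linarith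
      moreover have "Suc (2 * k - 1) = j" using True k by simp
      ultimately show ?thesis using True by simp
    next
      case False
      then show ?thesis using weighted_binomial_sum_less[of k j] j k n by simp
    qed
    finally have "real (\<Sum>i\<in>{..2 * k - 1}. ?f i * (n choose i)) < real (n choose j)"
      by (simp only: of_nat_less_iff)
    moreover have "0 < real (n choose j)" using jn by simp
    ultimately show ?thesis by (simp only: divide_less_eq_1_pos)
  qed
  finally show ?thesis .
qed

end

section \<open>The collection is a cover by proper subgroups\<close>

lemma subgroup_sym_groupI:
  assumes "\<And>g. g \<in> H \<Longrightarrow> g permutes {1..m}" "id \<in> H"
    "\<And>g h. g \<in> H \<Longrightarrow> h \<in> H \<Longrightarrow> g \<circ> h \<in> H" "\<And>g. g \<in> H \<Longrightarrow> inv' g \<in> H"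
  shows "subgroup H (sym_group m)"
proof
  show sub: "H \<subseteq> carrier (sym_group m)" using assms(1) sym_group_carrier by blast
  fix x assume "x \<in> H"
  thus "inv\<^bsub>sym_group m\<^esub> x \<in> H" using assms(4) sub sym_group_inv_equality by fastforce
qed (use assms in \<open>simp_all add: sym_group_mult sym_group_one\<close>)

lemma permutation_group_of_subgroup:
  assumes "subgroup M (sym_group m)"
  shows "permutation_group {1..m} M"
proof
  interpret subgroup M "sym_group m" by (rule assms)
  show perm: "g permutes {1..m}" if "g \<in> M" for g
    using that subset sym_group_carrier by blast
  show "id \<in> M" using one_closed by (simp add: sym_group_one)
  show "g \<circ> h \<in> M" if "g \<in> M" "h \<in> M" for g h using m_closed[OF that] by (simp add: sym_group_mult)
  show "inv' g \<in> M" if "g \<in> M" for g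
    using m_inv_closed[OF that] sym_group_inv_equality[of g m] subset that by auto
qed simp

lemma image_inv_eq:
  assumes "g permutes S" "g ` A = B"
  shows "inv' g ` B = A"
  unfolding assms(2)[symmetric] by (rule image_inv_f_f[OF permutes_inj[OF assms(1)]])

lemma subgroup_set_stabilizer: "subgroup (set_stabilizer m A) (sym_group m)"
proof (rule subgroup_sym_groupI)
  show "g \<circ> h \<in> set_stabilizer m A" if "g \<in> set_stabilizer m A" "h \<in> set_stabilizer m A" for g h
    using that permutes_compose[of h "{1..m}" g] image_comp[of g h A]
    unfolding set_stabilizer_def sym_group_carrier by simp
  show "inv' g \<in> set_stabilizer m A" if "g \<in> set_stabilizer m A" for g
    using that permutes_inv image_inv_eq unfolding set_stabilizer_def sym_group_carrier by blast
qed (auto simp: set_stabilizer_def sym_group_carrier)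

lemma subgroup_partition_stabilizer:
  assumes B: "B \<subseteq> {1..m}"
  shows "subgroup (partition_stabilizer m B) (sym_group m)"
proof (rule subgroup_sym_groupI)
  have dd: "{1..m} - ({1..m} - B) = B" using B by blast
  have swap: "g ` ({1..m} - B) = {1..m} - g ` B" if "g permutes {1..m}" for g
    using image_set_diff[OF permutes_inj[OF that]] permutes_image[OF that] by simp
  note iff = partition_stabilizer_iff[OF B]
  show "g \<circ> h \<in> partition_stabilizer m B"
    if g: "g \<in> partition_stabilizer m B" and h: "h \<in> partition_stabilizer m B" for g h
  proof -
    have gh: "g permutes {1..m}" "h permutes {1..m}" "g ` B = B \<or> g ` B = {1..m} - B" "h ` B = B \<or> h ` B = {1..m} - B"
      using g h iff by auto
    have "g ` h ` B = B \<or> g ` h ` B = {1..m} - B" using gh(3,4) swap[OF gh(1)] dd by metis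
    thus ?thesis unfolding iff image_comp[symmetric] using permutes_compose gh(1,2) by blast
  qed
  show "inv' g \<in> partition_stabilizer m B" if g: "g \<in> partition_stabilizer m B" for g
  proof -
    have g': "g permutes {1..m}" "g ` B = B \<or> g ` B = {1..m} - B" using g iff by auto
    hence "inv' g ` B = B \<or> inv' g ` B = {1..m} - B"
      using image_inv_eq[OF g'(1)] swap[OF g'(1)] dd by metis
    thus ?thesis unfolding iff using permutes_inv[OF g'(1)] by blast
  qed
qed (use partition_stabilizer_iff[OF B] in auto)

context degree_six
begin

lemma subgroup_optimal_cover:
  assumes "H \<in> optimal_cover n"
  shows "subgroup H (sym_group n)" "H \<noteq> carrier (sym_group n)"
proof -
  show "subgroup H (sym_group n)"
    using assms unfolding optimal_cover_eq component_def
    by (auto simp: half_sets_def subgroup_partition_stabilizer subgroup_set_stabilizer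
        alt_group_is_subgroup)
  obtain g where "g \<in> test_set" "g \<notin> H"
  proof (cases "H \<in> component ` low_sets")
    case True
    obtain g where "g \<in> full_cycles" using full_cycles_nonempty by blast
    moreover from this have "g \<notin> H" using full_cycle_not_component True by blast
    ultimately show ?thesis using that unfolding test_set_def by blast
  next
    case False
    then obtain B where B: "B \<in> half_sets" "H = partition_stabilizer n B"
      using assms unfolding optimal_cover_eq by blast
    obtain g where "g \<in> witnesses {}" using witnesses_nonempty[OF empty_low] by blast
    moreover from this have "g \<notin> H" using witnesses_not_partition_stabilizer[OF _ empty_low B(1)] B(2) by blast
    ultimately show ?thesis using that empty_low unfolding test_set_def by blast
  qed
  thus "H \<noteq> carrier (sym_group n)" using test_set_permutes sym_group_carrier by blast
qed

lemma optimal_cover_covers: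
  assumes g: "g permutes \<Omega>"
  shows "g \<in> \<Union>(optimal_cover n)"
proof (cases "evenperm g \<or> (\<exists>A\<in>low_sets. A \<noteq> {} \<and> g ` A = A)")
  case True
  then obtain A where "A \<in> low_sets" "g \<in> component A"
  proof
    assume "evenperm g"
    hence "g \<in> component {}" using g by (simp add: component_def alt_group_carrier)
    thus ?thesis using that empty_low by blast
  next
    assume "\<exists>A\<in>low_sets. A \<noteq> {} \<and> g ` A = A"
    then obtain A where A: "A \<in> low_sets" "A \<noteq> {}" "g ` A = A" by blast
    hence "g \<in> component A" using g by (simp add: component_def set_stabilizer_iff)
    thus ?thesis using that A by blast
  qed
  thus ?thesis unfolding optimal_cover_eq by blast
next
  case False
  have perm: "permutation g" using g permutation_permutes by blast
  define orb where "orb x = set (support g x)" for x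
  have self: "x \<in> orb x" for x
    unfolding orb_def support_set[OF perm] using funpow_0[of g x] by (metis rangeI)
  have cyc: "cycles_on g (orb x)" for x unfolding orb_def by (rule cycles_on_support[OF perm])
  have sub: "orb x \<subseteq> \<Omega>" if "x \<in> \<Omega>" for x
    using cycles_on_subset_or_disjoint[OF cyc permutes_image[OF g], of x] self[of x] that by blast
  let ?P = "orb ` \<Omega>"
  have U: "\<Union>?P = \<Omega>" using self sub by blast
  have disj: "pairwise disjnt ?P"
    using cycles_on_eq_or_disjoint[OF cyc cyc] unfolding pairwise_def disjnt_def by blast
  have large: "2 * k \<le> card X" if "X \<in> ?P" for X
  proof (rule ccontr)
    assume "\<not> ?thesis"
    hence c: "card X \<le> 2 * k - 1" by simp
    from that obtain x where x: "x \<in> \<Omega>" "X = orb x" by blast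
    have "X \<in> low_sets" using sub[OF x(1)] c x(2) unfolding low_sets_def by simp
    moreover have "X \<noteq> {}" "g ` X = X" using self[of x] cycles_on_image[OF cyc, of x] x(2) by auto
    ultimately show False using False by blast
  qed
  have finP: "finite ?P" by simp
  have finX: "finite X" if "X \<in> ?P" for X using U that finite_subset[of X \<Omega>] by blast
  have sum: "(\<Sum>X\<in>?P. card X) = 6 * k"
    using card_Union_disjoint[OF disj finX] U n by simp
  \<comment> \<open>The other orbits have at least 2 * k points each. This one inequality limits the
    number of orbits to three and, when there are three, forces each to have exactly 2 * k
    points.\<close>
  have bound: "card X + 2 * k * (card ?P - 1) \<le> 6 * k" if "X \<in> ?P" for X
  proof -
    have "(\<Sum>Y\<in>?P - {X}. 2 * k) \<le> (\<Sum>Y\<in>?P - {X}. card Y)" using large by (intro sum_mono) blast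
    hence "2 * k * (card ?P - 1) \<le> (\<Sum>Y\<in>?P - {X}. card Y)" using finP that by (simp add: mult.commute)
    thus ?thesis using sum sum.remove[OF finP that, of card] by simp
  qed
  have "evenperm g \<longleftrightarrow> even (card (\<Union>?P) + card ?P)"
  proof (rule evenperm_iff_cycles[OF finP _ disj])
    show "finite (\<Union>?P)" "g permutes \<Union>?P" using U g by simp_all
    show "X \<noteq> {} \<and> cycles_on g X" if "X \<in> ?P" for X using that self cyc by blast
  qed
  hence odd: "odd (card ?P)" using False U n by simp
  have one: "orb 1 \<in> ?P" using k n by simp
  have "card ?P \<le> 3"
  proof (rule ccontr)
    assume "\<not> ?thesis"
    hence "2 * k * 3 \<le> 2 * k * (card ?P - 1)" by (intro mult_le_mono2) simp
    thus False using bound[OF one] large[OF one] k by linarith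
  qed
  \<comment> \<open>Oddness of g excludes two orbits, the case in which odd cycle lengths could
    occur.\<close>
  hence c: "card ?P = 1 \<or> card ?P = 3" using odd by (auto simp: le_Suc_eq numeral_eq_Suc)
  have "even (card X)" if X: "X \<in> ?P" for X
    using c
  proof
    assume "card ?P = 1"
    hence "?P = {X}" using X by (metis card_1_singletonE singletonD)
    thus ?thesis using sum by simp
  next
    assume "card ?P = 3"
    hence "card X = 2 * k" using bound[OF X] large[OF X] by simp
    thus ?thesis by simp
  qed
  hence ev: "cycles_on g X \<and> even (card X)" if "X \<in> ?P" for X using that cyc by blast
  obtain B where "B \<in> half_sets" "g \<in> partition_stabilizer n B"
    by (rule alternating_partition[OF g finP U disj ev])
  thus ?thesis unfolding optimal_cover_eq by blast
qed

lemma is_cover_optimal_cover: "is_cover (sym_group n) (optimal_cover n)"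
  unfolding is_cover_def
proof (intro conjI ballI)
  show "\<Union>(optimal_cover n) = carrier (sym_group n)"
  proof
    show "\<Union>(optimal_cover n) \<subseteq> carrier (sym_group n)"
      using subgroup_optimal_cover(1) subgroup.subset by blast
    show "carrier (sym_group n) \<subseteq> \<Union>(optimal_cover n)"
      using optimal_cover_covers sym_group_carrier by blast
  qed
qed (use finite_optimal_cover subgroup_optimal_cover in auto)

lemma small_subgroup_weight:
  assumes "finite M" "2 ^ n * n ^ 3 * card M < 10 * fact n"
  shows "cover_weight (optimal_cover n) test_set M < 1"
proof (rule cover_weight_small[OF finite_optimal_cover assms(1)])
  show "H = H'" if "H \<in> optimal_cover n" "H' \<in> optimal_cover n" "x \<in> test_set" "x \<in> H" "x \<in> H'"
    for H H' x using optimal_cover_unique that by blast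
  fix H assume "H \<in> optimal_cover n"
  hence "2 ^ n * n ^ 3 * card M < 2 ^ n * n ^ 3 * card (H \<inter> test_set)"
    using optimal_cover_Int_large[of H] assms(2) by linarith
  thus "card M < card (H \<inter> test_set)" by simp
qed

section \<open>Arbitrary proper subgroups\<close>

text \<open>The bound on \<open>card J\<close> can always be met by passing to the complement. At
  exactly half of the points, fixing J is a special case of preserving the partition.\<close>

lemma intransitive_case:
  assumes M: "M \<subseteq> carrier (sym_group n)" and J: "J \<subseteq> \<Omega>" "J \<noteq> {}" "card J \<le> 3 * k"
    and inv: "\<And>g. g \<in> M \<Longrightarrow> g ` J = J"
  shows "(\<exists>H\<in>optimal_cover n. M \<subseteq> H) \<or> cover_weight (optimal_cover n) test_set M < 1"
proof -
  have sub: "M \<subseteq> set_stabilizer n J" using M inv unfolding set_stabilizer_def by blast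
  consider "card J \<le> 2 * k - 1" | "card J = 3 * k" | "2 * k \<le> card J" "card J < 3 * k"
    using J(3) by linarith
  then show ?thesis
  proof cases
    case 1
    then have "J \<in> low_sets" "component J = set_stabilizer n J"
      using J unfolding low_sets_def component_def by auto
    then have "set_stabilizer n J \<in> optimal_cover n" unfolding optimal_cover_eq by force
    then show ?thesis using sub by blast
  next
    case 2
    then have "partition_stabilizer n J \<in> optimal_cover n"
      using J unfolding optimal_cover_eq half_sets_def by blast
    moreover have "M \<subseteq> partition_stabilizer n J"
    proof
      fix g assume "g \<in> M"
      thus "g \<in> partition_stabilizer n J"
        using M inv[of g] partition_stabilizer_iff[OF J(1)] sym_group_carrier[of g n] by auto
    qed
    ultimately show ?thesis by blast
  next
    case 3
    have "J \<in> level (card J)" using J unfolding level_def by simp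
    then show ?thesis
      using cover_weight_set_stabilizer[OF _ 3] cover_weight_mono[OF finite_test_set sub]
      by (meson le_less_trans)
  qed
qed

lemma proper_subgroup_dichotomy:
  assumes M: "subgroup M (sym_group n)" "M \<noteq> carrier (sym_group n)"
  shows "(\<exists>H\<in>optimal_cover n. M \<subseteq> H) \<or> cover_weight (optimal_cover n) test_set M < 1"
proof -
  interpret permutation_group \<Omega> M by (rule permutation_group_of_subgroup[OF M(1)])
  have Msub: "M \<subseteq> carrier (sym_group n)" using M(1) by (rule subgroup.subset)
  consider "\<not> transitive" | "transitive" "\<not> primitive" | "primitive" by blast
  then show ?thesis
  proof cases
    case 1
    then obtain x y where xy: "x \<in> \<Omega>" "y \<in> \<Omega>" "\<And>g. g \<in> M \<Longrightarrow> g x \<noteq> y"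
      unfolding transitive_def by blast
    \<comment> \<open>The orbit of x misses y, so both J and its complement are nonempty invariant
      sets, and one of them has at most 3 * k points.\<close>
    define J where "J = (\<lambda>g. g x) ` M"
    have JO: "J \<subseteq> \<Omega>" using xy(1) permutes_in_image[OF permutes_M] unfolding J_def by blast
    have xJ: "x \<in> J" unfolding J_def using rev_image_eqI[OF id_M, of x "\<lambda>g. g x"] by simp
    have yJ: "y \<notin> J" using xy(3) unfolding J_def by blast
    have inv: "g ` J = J" if g: "g \<in> M" for g
    proof
      show "g ` J \<subseteq> J"
      proof clarify
        fix z assume "z \<in> J"
        then obtain h where h: "h \<in> M" "z = h x" unfolding J_def by blast
        have "g z = (g \<circ> h) x" using h by simp
        thus "g z \<in> J" using comp_M[OF g h(1)] unfolding J_def by blast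
      qed
      show "J \<subseteq> g ` J"
      proof
        fix z assume "z \<in> J"
        then obtain h where h: "h \<in> M" "z = h x" unfolding J_def by blast
        have "z = g ((inv' g \<circ> h) x)" using h permutes_inverses[OF permutes_M[OF g]] by simp
        moreover have "(inv' g \<circ> h) x \<in> J" using comp_M[OF inv_M[OF g] h(1)] unfolding J_def by blast
        ultimately show "z \<in> g ` J" by blast
      qed
    qed
    have invc: "g ` (\<Omega> - J) = \<Omega> - J" if g: "g \<in> M" for g
      using image_set_diff[OF permutes_inj[OF permutes_M[OF g]]] permutes_image[OF permutes_M[OF g]]
        inv[OF g] by simp
    have "card J + card (\<Omega> - J) = n"
      using JO card_mono[OF _ JO] by (simp add: card_Diff_subset finite_subset)
    then consider "card J \<le> 3 * k" | "card (\<Omega> - J) \<le> 3 * k" using n by linarith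
    then show ?thesis
    proof cases
      case 1
      then show ?thesis using intransitive_case[OF Msub JO _ _ inv] xJ by blast
    next
      case 2
      then show ?thesis using intransitive_case[OF Msub _ _ _ invc] xy(2) yJ by blast
    qed
  next
    case 2
    then obtain R where R: "invariant_relation R" "\<not> R \<subseteq> Id" "R \<noteq> \<Omega> \<times> \<Omega>"
      unfolding primitive_def by blast
    obtain b where b: "\<And>X. X \<in> \<Omega> // R \<Longrightarrow> card X = b" "card (\<Omega> // R) * b = card \<Omega>"
        "2 \<le> b" "2 \<le> card (\<Omega> // R)"
      using transitive_classes[OF R 2(1)] by metis
    let ?m = "card (\<Omega> // R)"
    have mb: "?m * b = n" using b(2) by simp
    have eq: "equiv \<Omega> R" using R(1) unfolding invariant_relation_def by simp
    show ?thesis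
    proof (cases "?m = 2")
      case True
      have one: "1 \<in> \<Omega>" using k n by simp
      define B where "B = R `` {1}"
      have BQ: "B \<in> \<Omega> // R" unfolding B_def using one by (rule quotientI)
      have BO: "B \<subseteq> \<Omega>" using BQ Union_quotient[OF eq] by blast
      have cB: "card B = 3 * k" using b(1)[OF BQ] mb True n by simp
      obtain X Y where XY: "\<Omega> // R = {X, Y}" "X \<noteq> Y" using True by (auto simp: card_2_iff)
      have "X \<union> Y = \<Omega>" "X \<inter> Y = {}"
        using XY Union_quotient[OF eq] quotient_disj[OF eq, of X Y] by auto
      \<comment> \<open>Two blocks are a half and its complement, so M lies in a member; order
        bounds are needed only from three blocks on.\<close>
      hence Q: "\<Omega> // R = {B, \<Omega> - B}" using XY BQ by auto
      have "g ` B = B \<or> g ` B = \<Omega> - B" if g: "g \<in> M" for g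
      proof -
        have "g ` B = R `` {g 1}" unfolding B_def by (rule invariant_relation_class_image[OF R(1) g])
        moreover have "g 1 \<in> \<Omega>" using one permutes_in_image[OF permutes_M[OF g]] by blast
        ultimately have "g ` B \<in> \<Omega> // R" by (simp only: quotientI)
        thus ?thesis unfolding Q insert_iff empty_iff by (simp only: simp_thms)
      qed
      hence "M \<subseteq> partition_stabilizer n B" using partition_stabilizer_iff[OF BO] permutes_M by blast
      moreover have "partition_stabilizer n B \<in> optimal_cover n"
        using BO cB unfolding optimal_cover_eq half_sets_def by blast
      ultimately show ?thesis by blast
    next
      case False
      have "card M \<le> fact b ^ ?m * fact ?m" by (rule card_invariant_relation_le[OF R(1) b(1)])
      hence "2 ^ n * n ^ 3 * card M \<le> 2 ^ n * n ^ 3 * (fact b ^ ?m * fact ?m)" by (rule mult_le_mono2)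
      also have "\<dots> < 10 * fact n"
      proof -
        have "blocks_bound ?m b" using False b(3,4) mb k n by (intro blocks_bound) auto
        thus ?thesis unfolding blocks_bound_def mb by (simp only: ac_simps)
      qed
      finally show ?thesis using small_subgroup_weight[OF finite_M] by blast
    qed
  next
    case 3
    show ?thesis
    proof (cases "\<exists>a b c. three_cycle_in a b c")
      case True
      then obtain u v w where uvw: "three_cycle_in u v w" by blast
      \<comment> \<open>Three-cycles generate the alternating group, so M contains all even
        permutations.\<close>
      have three: "three_cycles n \<subseteq> M"
      proof
        fix p assume "p \<in> three_cycles n"
        then obtain cs where cs: "p = cycle_of_list cs" "distinct cs" "length cs = 3" "set cs \<subseteq> \<Omega>"
          by blast
        then obtain a b c where abc: "cs = [a, b, c]" by (auto simp: numeral_3_eq_3 length_Suc_conv)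
        have "three_cycle_in a b c" using all_three_cycles[OF 3 uvw] cs abc by simp
        thus "p \<in> M" using cs abc unfolding three_cycle_in_def by simp
      qed
      have alt: "p \<in> M" if "p \<in> generate (alt_group n) (three_cycles n)" for p
        using that
      proof (induction rule: generate.induct)
        case one
        show ?case unfolding alt_group_one by (rule id_M)
      next
        case (incl h)
        then show ?case using three by blast
      next
        case (inv h)
        then have "inv\<^bsub>alt_group n\<^esub> h = inv' h" using three_cycles_incl alt_group_inv_equality by blast
        moreover have "h \<in> M" using inv three by blast
        ultimately show ?case using inv_M by simp
      next
        case (eng h1 h2)
        then show ?case unfolding alt_group_mult by (intro comp_M)
      qed
      have altM: "p \<in> M" if "p permutes \<Omega>" "evenperm p" for p
        using that alt[of p] alt_group_carrier[of p n] alt_group_carrier_as_three_cycles[of n] by simp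
      \<comment> \<open>Two odd permutations differ by an even one, so a single odd element would
        make M the whole symmetric group.\<close>
      have "M \<subseteq> carrier (alt_group n)"
      proof (rule ccontr)
        assume "\<not> ?thesis"
        then obtain p where p: "p \<in> M" "\<not> evenperm p" using permutes_M alt_group_carrier by blast
        have pp: "p permutes \<Omega>" using p permutes_M by blast
        have "q \<in> M" if q: "q permutes \<Omega>" for q
        proof (cases "evenperm q")
          case True
          then show ?thesis using altM[OF q] by simp
        next
          case False
          have perm: "permutation p" "permutation q" using pp q permutation_permutes by blast+
          have "evenperm (inv' p \<circ> q)"
            using evenperm_comp[OF permutation_inverse[OF perm(1)] perm(2)] evenperm_inv[OF perm(1)]
              p(2) False by simp
          moreover have "inv' p \<circ> q permutes \<Omega>" using pp q permutes_compose permutes_inv by blast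
          ultimately have "inv' p \<circ> q \<in> M" by (intro altM)
          hence "p \<circ> (inv' p \<circ> q) \<in> M" using comp_M p(1) by blast
          moreover have "p \<circ> (inv' p \<circ> q) = q" using permutes_inverses[OF pp] by (simp add: fun_eq_iff)
          ultimately show ?thesis by simp
        qed
        hence "carrier (sym_group n) \<subseteq> M" using sym_group_carrier by blast
        thus False using M(2) Msub by blast
      qed
      moreover have "carrier (alt_group n) \<in> optimal_cover n" unfolding optimal_cover_def by blast
      ultimately show ?thesis by blast
    next
      case False
      have "card M * fact (3 * k) \<le> (fact (card \<Omega>) :: nat)"
        using False n by (intro Bochert) auto
      hence B: "card M * fact (3 * k) \<le> (fact n :: nat)" by simp
      \<comment> \<open>Bochert's bound gives M index at least \<open>fact (3 * k)\<close>, which is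
        more than \<open>2 ^ n * n ^ 3 / 10\<close>.\<close>
      have "2 ^ n * n ^ 3 < (10 * fact (3 * k) :: nat)"
        using two_power_cube_less_fact[of "3 * k"] k n by simp
      moreover have "0 < card M" using finite_M id_M by (auto simp: card_gt_0_iff)
      ultimately have "2 ^ n * n ^ 3 * card M < 10 * fact (3 * k) * card M" by simp
      also have "\<dots> = 10 * (card M * fact (3 * k))" by simp
      also have "\<dots> \<le> 10 * fact n" using B by (rule mult_le_mono2)
      finally show ?thesis using small_subgroup_weight[OF finite_M] by blast
    qed
  qed
qed

theorem optimal_cover_definitely_unbeatable:
  "covering_number (sym_group n) = card (optimal_cover n)"
  "is_cover (sym_group n) C \<and> card C = card (optimal_cover n) \<and>
     (\<forall>H\<in>C. maximal_subgroup H (sym_group n)) \<longleftrightarrow> C = optimal_cover n"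
proof -
  have sub: "test_set \<subseteq> carrier (sym_group n)" using test_set_permutes sym_group_carrier by blast
  note unb = definitely_unbeatable[OF is_cover_optimal_cover finite_test_set sub
      optimal_cover_unique optimal_cover_Int_nonempty proper_subgroup_dichotomy]
  show "covering_number (sym_group n) = card (optimal_cover n)" by (rule unb(1))
  show "is_cover (sym_group n) C \<and> card C = card (optimal_cover n) \<and>
     (\<forall>H\<in>C. maximal_subgroup H (sym_group n)) \<longleftrightarrow> C = optimal_cover n" by (rule unb(2))
qed

end

theorem theorem3p1:
  fixes n :: nat
  assumes "n mod 6 = 0" and "n > 30"
  shows "real (covering_number (sym_group n)) =
           (1/2) * real (n choose (n div 2)) + (\<Sum>i = 0..n div 3 - 1. real (n choose i))
         \<and> (\<forall>C. (is_cover (sym_group n) C \<and> card C = covering_number (sym_group n) \<and>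
               (\<forall>H\<in>C. maximal_subgroup H (sym_group n)))
             \<longleftrightarrow> C = optimal_cover n)"
proof -
  obtain k where k: "n = 6 * k" using assms(1) by auto
  then interpret degree_six k n using assms(2) by unfold_locales auto
  show ?thesis
    unfolding optimal_cover_definitely_unbeatable(1)
    using card_optimal_cover optimal_cover_definitely_unbeatable(2) by blast
qed

end
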